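(* Let $Y^*_\#$ be connected (case $l=0$). Let $(u_0,u_1)\in H^1(\Omega)\times L^2(\Omega;H^1_\#(Y^*_x)/\mathbb R)$ be the unique solution of $$\int_\Omega\int_{Y^*_x}A_0(x,y)(\nabla_x u_0(x)+\nabla_y u_1(x,y))\cdot(\nabla_x\varphi_0(x)+\nabla_y\varphi_1(x,y))+u_0(x)\varphi_0(x)\,dy\,dx=\int_\Omega\int_{Y^*_x}f_0(x,y)\,dy\,\varphi_0(x)\,dx$$ for every $(\varphi_0,\varphi_1)\in H^1(\Omega)\times L^2(\Omega;H^1_\#(Y^*_x)/\mathbb R)$. Then $u_0$ solves $$\int_\Omega B_0(x)\nabla u_0(x)\cdot\nabla\varphi(x)+\Theta(x)u_0(x)\varphi(x)\,dx=\int_\Omega\int_{Y^*_x}f_0(x,y)\,dy\,\varphi(x)\,dx$$ for every $\varphi\in H^1(\Omega)$, where $\Theta(x):=\int_{Y^*_x}1\,dy=|Y^*_x|$ and $B_0\in L^\infty(\Omega)^{N\times N}$ is given by $$(B_0)_{ij}(x):=\int_{Y^*_x}\delta_{ij}+\partial_{y_i}w_j(x,y)\,dy,$$ and $w_j$ is defined as the unique solution $w_j\in L^2(\Omega;H^1_\#(Y^*_x)/\mathbb R)$ such that $$\int_\Omega\int_{Y^*_x}(\nabla_y w_j(x,y)+e_j)\cdot\nabla_y\varphi(x,y)\,dy\,dx=0$$ for every $\varphi\in L^2(\Omega;H^1_\#(Y^*_x)/\mathbb R)$ (with $e_j$ the $j$-th Euclidean unit vector and $\delta_{ij}$ the Kronecker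 delta).
   Context: Conventions. $(\varepsilon)=(\varepsilon_n)_{n\in\mathbb N}$ is a fixed sequence of positive numbers converging to $0$ (index suppressed); constants $C,c_J,\alpha>0$ are independent of $\varepsilon$. $Y=[0,1]^N$; the subscript $\#$ denotes $Y$-periodicity in $y$. Two-scale convergence. Let $U\subset\mathbb R^N$ be bounded and open and $p,q\in(1,\infty)$ with $1/p+1/q=1$. A sequence $v_\varepsilon\in L^p(U)$ two-scale converges weakly in $L^p$ to $v_0\in L^p(U\times Y)$ if $\lim_{\varepsilon\to0}\int_U v_\varepsilon(x)\varphi(x,x/\varepsilon)\,dx=\int_U\int_Y v_0(x,y)\varphi(x,y)\,dy\,dx$ for all $\varphi\in L^q(U;C_\#(Y))$ (componentwise for vector- or matrix-valued functions). It converges strongly in $L^p$ if in addition $\lim_{\varepsilon\to0}\|v_\varepsilon\|_{L^p(U)}=\|v_0\|_{L^p(U\times Y)}$. Geometry. $Y^*\subset Y$ is open and $Y^*_\#:=\operatorname{int}\big(\bigcup_{k\in\mathbb Z^N}(k+\overline{Y^*})\big)$ has Lipschitz boundary. $\Omega\subset\mathbb R^N$ is bounded, open, with Lipschitz boundary, and $\hat\Omega_\varepsilon:=\Omega\cap\varepsilon Y^*_\#$. Extension by zero is denoted by $\widetilde{\cdot}$: functions on $\hat\Omega_\varepsilon$ are extended to $\Omega$, functions on $\Omega\times Y^*$ to $\Omega\times Y$. Locally periodic transformations. A sequence of $C^1$-diffeomorphisms $\psi_\varepsilon:\overline{\hat\Omega_\varepsilon}\to\overline{\Omega_\varepsilon}$,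 $\Omega_\varepsilon:=\psi_\varepsilon(\hat\Omega_\varepsilon)\subset\mathbb R^N$, is a sequence of locally periodic transformations if: (1) there is $c_J>0$ with $J_\varepsilon:=\det\Psi_\varepsilon\ge c_J$, where $\Psi_\varepsilon:=D\psi_\varepsilon$; (2) with $\check\psi_\varepsilon(x):=\psi_\varepsilon(x)-x$ there is $C>0$ with $\varepsilon^{-1}\|\check\psi_\varepsilon\|_{C(\overline{\hat\Omega_\varepsilon})}+\|\nabla\check\psi_\varepsilon\|_{C(\overline{\hat\Omega_\varepsilon})}\le C$; (3) there is $\psi_0\in L^\infty(\Omega;C^1(\overline{Y^*}))^N$ (the limit transformation) such that (a) for a.e. $x\in\Omega$, $\psi_0(x,\cdot):\overline{Y^*}\to\overline{Y^*_x}$ with $Y^*_x:=\psi_0(x,Y^* )\subset Y$ is a $C^1$-diffeomorphism, (b) $\check\psi_0(x,y):=\psi_0(x,y)-y$ can be extended $Y$-periodically such that $\check\psi_0\in L^\infty(\Omega;C^1_\#(\overline{Y^*}))^N$, (c) for every $q\in(1,\infty)$, $\varepsilon^{-1}\widetilde{\check\psi_\varepsilon}$ and $\widetilde{\nabla\check\psi_\varepsilon}$ two-scale converge strongly in $L^q$ (on $U=\Omega$) to $\widetilde{\check\psi_0}$ and $\widetilde{\nabla_y\check\psi_0}$, respectively. $\psi_0^{-1}(x,\cdot)$ denotes the inverse of $\psi_0(x,\cdot)$. A sequence $(\psi_\varepsilon)$ of locally periodic transformations with limit transformation $\psi_0$ is fixed. Functions on $\Omega_\varepsilon$. Let $Q:=\{(x,y)\in\Omega\times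 Y: y\in Y^*_x\}$. A small $\delta>0$ is fixed and $\Omega^{(\delta)}:=\{x\in\mathbb R^N:\operatorname{dist}(x,\Omega)<\delta\}$; then $\Omega_\varepsilon\subset\Omega^{(\delta)}$ for $\varepsilon$ small enough. Functions on $\Omega_\varepsilon$ are extended by $0$ to $\Omega^{(\delta)}$ and functions on $Q$ by $0$ to $\Omega^{(\delta)}\times Y$ (also denoted $\widetilde{\cdot}$). Two-scale convergence of extended functions on $\Omega_\varepsilon$ is meant on $U=\Omega^{(\delta)}$. Function spaces. $H^1_\#(Y^* )$ is the space of functions in $H^1(Y^* )$ that are $Y$-periodic (periodic extension in $H^1_{loc}(Y^*_\#)$). $L^2(\Omega;L^2(Y^*_x))$ and $L^2(\Omega;H^1_\#(Y^*_x))$ are the sets of functions $(x,y)\mapsto f(x,\psi_0^{-1}(x,y))$ with $f\in L^2(\Omega;L^2(Y^* ))$, resp. $f\in L^2(\Omega;H^1_\#(Y^* ))$, with norms $\|u\|_{L^2(Q)}$, resp. $\|u\|_{L^2(Q)}+\|\nabla_y u\|_{L^2(Q)}$. The quotient "$/\mathbb R$" identifies functions differing by a function of $x$ only. Data. $A_\varepsilon\in L^\infty(\Omega_\varepsilon)^{N\times N}$ with $\|A_\varepsilon\|_{L^\infty(\Omega_\varepsilon)}\le C$ and $\xi^\top A_\varepsilon(x)\xi\ge\alpha\|\xi\|^2$ for all $\varepsilon$, a.e. $x\in\Omega_\varepsilon$ and all $\xi\in\mathbb R^N$; $f_\varepsilon\in L^2(\Omega_\varepsilon)$. There is a coercive $A_0\in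 L^\infty(Q)^{N\times N}$ such that $\widetilde{A_\varepsilon}$ two-scale converges strongly in $L^q$ to $\widetilde{A_0}$ for every $q\in(1,\infty)$, and there is $f_0\in L^2(\Omega;L^2(Y^*_x))$ such that $\widetilde{f_\varepsilon}$ two-scale converges weakly in $L^2$ to $\widetilde{f_0}$.
   Formalization: The printed claim fails for general A_0 (e.g. A_0 = 2I, Y* = (0,1)^N); A_0 is inserted: the cell problem reads ∫∫A_0(∇_y w_j+e_j)·∇_yφ = 0 and (B_0)_ij = ∫[A_0(e_j+∇_y w_j)]_i dy, agreeing with the printed formulas for A_0 = I. *)

theory Defs
  imports "HOL-Analysis.Analysis"
begin

section \<open>Lebesgue spaces\<close>

definition lp_space :: "'a::euclidean_space set \<Rightarrow> real \<Rightarrow> ('a \<Rightarrow> 'b::euclidean_space) \<Rightarrow> bool" where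
  "lp_space S p f \<longleftrightarrow>
     f \<in> borel_measurable (lebesgue_on S) \<and>
     integrable (lebesgue_on S) (\<lambda>x. norm (f x) powr p)"

definition lp_norm :: "'a::euclidean_space set \<Rightarrow> real \<Rightarrow> ('a \<Rightarrow> 'b::euclidean_space) \<Rightarrow> real" where
  "lp_norm S p f = (LINT x|lebesgue_on S. norm (f x) powr p) powr (1 / p)"

definition linf_space :: "'a::euclidean_space set \<Rightarrow> ('a \<Rightarrow> 'b::euclidean_space) \<Rightarrow> bool" where
  "linf_space S f \<longleftrightarrow>
     f \<in> borel_measurable (lebesgue_on S) \<and>
     (\<exists>C. AE x in lebesgue_on S. norm (f x) \<le> C)"

definition ext0 :: "'a set \<Rightarrow> ('a \<Rightarrow> 'b::zero) \<Rightarrow> 'a \<Rightarrow> 'b" where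
  "ext0 S f x = (if x \<in> S then f x else 0)"

section \<open>Sobolev spaces\<close>

text \<open>Smoothness: \<open>F ks\<close> is the iterated partial derivative along the list of indices \<open>ks\<close>.\<close>

definition smooth_function :: "(real^'n \<Rightarrow> real) \<Rightarrow> bool" where
  "smooth_function f \<longleftrightarrow>
     (\<exists>F :: 'n list \<Rightarrow> real^'n \<Rightarrow> real.
        F [] = f \<and>
        (\<forall>ks. continuous_on UNIV (F ks)) \<and>
        (\<forall>ks i x. ((\<lambda>t. F ks (x + t *\<^sub>R axis i 1)) has_real_derivative F (i # ks) x) (at 0)))"

definition test_functions :: "(real^'n) set \<Rightarrow> (real^'n \<Rightarrow> real) set" where
  "test_functions U =
     {\<phi>. smooth_function \<phi> \<and> (\<exists>K. compact K \<and> K \<subseteq> U \<and> (\<forall>x. x \<notin> K \<longrightarrow> \<phi> x = 0))}"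

text \<open>Sobolev functions are represented by pairs of a function and its weak gradient, related by
  predicates (as in \<open>has_derivative\<close>); for open \<open>U\<close> the weak gradient is unique up to
  null sets.\<close>

definition has_weak_gradient ::
    "(real^'n \<Rightarrow> real) \<Rightarrow> (real^'n \<Rightarrow> real^'n) \<Rightarrow> (real^'n) set \<Rightarrow> bool" where
  "has_weak_gradient u Du U \<longleftrightarrow>
     (\<forall>K. compact K \<and> K \<subseteq> U \<longrightarrow> integrable (lebesgue_on K) u \<and> integrable (lebesgue_on K) Du) \<and>
     (\<forall>\<phi> \<in> test_functions U. \<forall>i.
        (LINT x|lebesgue_on U. u x * frechet_derivative \<phi> (at x) (axis i 1)) =
        - (LINT x|lebesgue_on U. Du x $ i * \<phi> x))"

definition H1 :: "(real^'n) set \<Rightarrow> (real^'n \<Rightarrow> real) \<Rightarrow> (real^'n \<Rightarrow> real^'n) \<Rightarrow> bool" where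
  "H1 U u Du \<longleftrightarrow> lp_space U 2 u \<and> lp_space U 2 Du \<and> has_weak_gradient u Du U"

definition H1_loc :: "(real^'n) set \<Rightarrow> (real^'n \<Rightarrow> real) \<Rightarrow> (real^'n \<Rightarrow> real^'n) \<Rightarrow> bool" where
  "H1_loc U u Du \<longleftrightarrow>
     (\<forall>K. compact K \<and> K \<subseteq> U \<longrightarrow> lp_space K 2 u \<and> lp_space K 2 Du) \<and>
     has_weak_gradient u Du U"

section \<open>Periodicity and the perforated geometry\<close>

definition Ycell :: "(real^'n) set" where
  "Ycell = cbox 0 One"

definition int_vecs :: "(real^'n) set" where
  "int_vecs = {k. \<forall>i. k $ i \<in> \<int>}"

text \<open>The periodic open set \<open>Y\<^sup>*\<^sub>#\<close> generated by \<open>Y\<^sup>*\<close>.\<close>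

definition periodic_hull :: "(real^'n) set \<Rightarrow> (real^'n) set" where
  "periodic_hull Ystar = interior (\<Union>k\<in>int_vecs. (\<lambda>y. k + y) ` closure Ystar)"

definition lipschitz_boundary :: "(real^'n) set \<Rightarrow> bool" where
  "lipschitz_boundary S \<longleftrightarrow>
     (\<forall>p \<in> frontier S. \<exists>V e L \<gamma>.
        open V \<and> p \<in> V \<and> norm e = 1 \<and> L-lipschitz_on UNIV (\<gamma> :: real^'n \<Rightarrow> real) \<and>
        S \<inter> V = {x \<in> V. x \<bullet> e > \<gamma> (x - (x \<bullet> e) *\<^sub>R e)})"

definition perforated_domain ::
    "(nat \<Rightarrow> real) \<Rightarrow> (real^'n) set \<Rightarrow> (real^'n) set \<Rightarrow> nat \<Rightarrow> (real^'n) set" where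
  "perforated_domain \<epsilon> \<Omega> Ystar n = \<Omega> \<inter> (\<lambda>y. \<epsilon> n *\<^sub>R y) ` periodic_hull Ystar"

definition H1_per ::
    "(real^'n) set \<Rightarrow> (real^'n \<Rightarrow> real) \<Rightarrow> (real^'n \<Rightarrow> real^'n) \<Rightarrow> bool" where
  "H1_per Ystar v Dv \<longleftrightarrow>
     H1 Ystar v Dv \<and>
     (\<exists>w Dw. H1_loc (periodic_hull Ystar) w Dw \<and>
        (\<forall>y. \<forall>k \<in> int_vecs. w (y + k) = w y) \<and>
        (AE y in lebesgue_on Ystar. w y = v y))"

section \<open>Two-scale convergence\<close>

text \<open>\<open>L\<^sup>q(U; C\<^sub>#(Y))\<close>: since \<open>C\<^sub>#(Y)\<close> is separable, Bochner measurability is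
  measurability of all point evaluations.\<close>

definition admissible_test ::
    "(real^'n) set \<Rightarrow> real \<Rightarrow> (real^'n \<Rightarrow> real^'n \<Rightarrow> real) \<Rightarrow> bool" where
  "admissible_test U q \<phi> \<longleftrightarrow>
     (AE x in lebesgue_on U. continuous_on UNIV (\<phi> x) \<and>
        (\<forall>y. \<forall>k \<in> int_vecs. \<phi> x (y + k) = \<phi> x y)) \<and>
     (\<forall>y. (\<lambda>x. \<phi> x y) \<in> borel_measurable (lebesgue_on U)) \<and>
     integrable (lebesgue_on U) (\<lambda>x. (SUP y\<in>Ycell. \<bar>\<phi> x y\<bar>) powr q)"

text \<open>Componentwise for vector- and matrix-valued functions.\<close>

definition two_scale_weakly ::
    "(real^'n) set \<Rightarrow> (nat \<Rightarrow> real) \<Rightarrow> real \<Rightarrow> (nat \<Rightarrow> real^'n \<Rightarrow> 'b::euclidean_space)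
      \<Rightarrow> ((real^'n) \<times> (real^'n) \<Rightarrow> 'b) \<Rightarrow> bool" where
  "two_scale_weakly U \<epsilon> p v v0 \<longleftrightarrow>
     (\<forall>n. lp_space U p (v n)) \<and> lp_space (U \<times> Ycell) p v0 \<and>
     (\<forall>q \<phi>. 1 < q \<and> 1 / p + 1 / q = 1 \<and> admissible_test U q \<phi> \<longrightarrow>
        (\<forall>b\<in>Basis.
          (\<lambda>n. LINT x|lebesgue_on U. (v n x \<bullet> b) * \<phi> x ((1 / \<epsilon> n) *\<^sub>R x)) \<longlonglongrightarrow>
          (LINT x|lebesgue_on U. LINT y|lebesgue_on Ycell. (v0 (x, y) \<bullet> b) * \<phi> x y)))"

definition two_scale_strongly ::
    "(real^'n) set \<Rightarrow> (nat \<Rightarrow> real) \<Rightarrow> real \<Rightarrow> (nat \<Rightarrow> real^'n \<Rightarrow> 'b::euclidean_space)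
      \<Rightarrow> ((real^'n) \<times> (real^'n) \<Rightarrow> 'b) \<Rightarrow> bool" where
  "two_scale_strongly U \<epsilon> p v v0 \<longleftrightarrow>
     two_scale_weakly U \<epsilon> p v v0 \<and>
     (\<lambda>n. lp_norm U p (v n)) \<longlonglongrightarrow> lp_norm (U \<times> Ycell) p v0"

section \<open>Locally periodic transformations\<close>

text \<open>\<open>C\<^sup>1(closure U)\<close> for open \<open>U\<close>: the derivative extends continuously to the closure.\<close>

definition C1_closure :: "(real^'n) set \<Rightarrow> (real^'n \<Rightarrow> real^'n) \<Rightarrow> bool" where
  "C1_closure U f \<longleftrightarrow>
     continuous_on (closure U) f \<and> (\<forall>x\<in>U. f differentiable at x) \<and>
     (\<exists>D. continuous_on (closure U) D \<and> (\<forall>x\<in>U. D x = jacobian f (at x)))"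

definition C1_diffeo_closure :: "(real^'n) set \<Rightarrow> (real^'n \<Rightarrow> real^'n) \<Rightarrow> bool" where
  "C1_diffeo_closure U f \<longleftrightarrow>
     C1_closure U f \<and> bij_betw f (closure U) (closure (f ` U)) \<and>
     C1_closure (f ` U) (inv_into (closure U) f)"

text \<open>\<open>L\<^sup>\<infinity>(\<Omega>; C\<^sup>1(closure Y\<^sup>*))\<close>; Bochner measurability is again measurability of the
  point evaluations.\<close>

definition linf_C1 ::
    "(real^'n) set \<Rightarrow> (real^'n) set \<Rightarrow> (real^'n \<Rightarrow> real^'n \<Rightarrow> real^'n) \<Rightarrow> bool" where
  "linf_C1 \<Omega> Ystar g \<longleftrightarrow>
     (AE x in lebesgue_on \<Omega>. C1_closure Ystar (g x)) \<and>
     (\<forall>y \<in> closure Ystar. (\<lambda>x. g x y) \<in> borel_measurable (lebesgue_on \<Omega>)) \<and>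
     (\<exists>M. AE x in lebesgue_on \<Omega>.
        (\<forall>y \<in> closure Ystar. norm (g x y) \<le> M) \<and>
        (\<forall>y \<in> Ystar. norm (jacobian (g x) (at y)) \<le> M))"

text \<open>In the periodicity clause, boundedness and measurability of the extension are inherited
  from \<open>\<psi>0\<close>, so that it suffices to extend pointwise in \<open>x\<close>.\<close>

definition limit_transformation ::
    "(real^'n) set \<Rightarrow> (real^'n) set \<Rightarrow> (real^'n \<Rightarrow> real^'n \<Rightarrow> real^'n) \<Rightarrow> bool" where
  "limit_transformation \<Omega> Ystar \<psi>0 \<longleftrightarrow>
     linf_C1 \<Omega> Ystar \<psi>0 \<and>
     (AE x in lebesgue_on \<Omega>. C1_diffeo_closure Ystar (\<psi>0 x) \<and> \<psi>0 x ` Ystar \<subseteq> Ycell) \<and>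
     (AE x in lebesgue_on \<Omega>. \<exists>g.
        (\<forall>y. \<forall>k \<in> int_vecs. g (y + k) = g y) \<and>
        C1_closure (periodic_hull Ystar) g \<and>
        (\<forall>y \<in> closure Ystar. g y = \<psi>0 x y - y))"

definition locally_periodic_transformations ::
    "(nat \<Rightarrow> real) \<Rightarrow> (real^'n) set \<Rightarrow> (real^'n) set
      \<Rightarrow> (nat \<Rightarrow> real^'n \<Rightarrow> real^'n) \<Rightarrow> (real^'n \<Rightarrow> real^'n \<Rightarrow> real^'n) \<Rightarrow> bool" where
  "locally_periodic_transformations \<epsilon> \<Omega> Ystar \<psi> \<psi>0 \<longleftrightarrow>
     (\<forall>n. C1_diffeo_closure (perforated_domain \<epsilon> \<Omega> Ystar n) (\<psi> n)) \<and>
     (\<exists>cJ>0. \<forall>n. \<forall>x \<in> perforated_domain \<epsilon> \<Omega> Ystar n. det (jacobian (\<psi> n) (at x)) \<ge> cJ) \<and>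
     (\<exists>C>0. \<forall>n.
        (\<forall>x \<in> closure (perforated_domain \<epsilon> \<Omega> Ystar n). norm (\<psi> n x - x) / \<epsilon> n \<le> C) \<and>
        (\<forall>x \<in> perforated_domain \<epsilon> \<Omega> Ystar n. norm (jacobian (\<lambda>z. \<psi> n z - z) (at x)) \<le> C)) \<and>
     limit_transformation \<Omega> Ystar \<psi>0 \<and>
     (\<forall>q>1.
        two_scale_strongly \<Omega> \<epsilon> q
          (\<lambda>n. ext0 (perforated_domain \<epsilon> \<Omega> Ystar n) (\<lambda>x. (1 / \<epsilon> n) *\<^sub>R (\<psi> n x - x)))
          (ext0 (\<Omega> \<times> Ystar) (\<lambda>(x, y). \<psi>0 x y - y)) \<and>
        two_scale_strongly \<Omega> \<epsilon> q
          (\<lambda>n. ext0 (perforated_domain \<epsilon> \<Omega> Ystar n) (\<lambda>x. jacobian (\<lambda>z. \<psi> n z - z) (at x)))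
          (ext0 (\<Omega> \<times> Ystar) (\<lambda>(x, y). jacobian (\<lambda>z. \<psi>0 x z - z) (at y))))"

definition transformed_domain ::
    "(nat \<Rightarrow> real) \<Rightarrow> (real^'n) set \<Rightarrow> (real^'n) set
      \<Rightarrow> (nat \<Rightarrow> real^'n \<Rightarrow> real^'n) \<Rightarrow> nat \<Rightarrow> (real^'n) set" where
  "transformed_domain \<epsilon> \<Omega> Ystar \<psi> n = \<psi> n ` perforated_domain \<epsilon> \<Omega> Ystar n"

definition Yx :: "(real^'n) set \<Rightarrow> (real^'n \<Rightarrow> real^'n \<Rightarrow> real^'n) \<Rightarrow> real^'n \<Rightarrow> (real^'n) set" where
  "Yx Ystar \<psi>0 x = \<psi>0 x ` Ystar"

definition Qset ::
    "(real^'n) set \<Rightarrow> (real^'n) set \<Rightarrow> (real^'n \<Rightarrow> real^'n \<Rightarrow> real^'n) \<Rightarrow> ((real^'n) \<times> (real^'n)) set" where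
  "Qset \<Omega> Ystar \<psi>0 = {(x, y). x \<in> \<Omega> \<and> y \<in> Ycell \<and> y \<in> Yx Ystar \<psi>0 x}"

definition neighbourhood :: "(real^'n) set \<Rightarrow> real \<Rightarrow> (real^'n) set" where
  "neighbourhood \<Omega> \<delta> = {x. \<exists>z\<in>\<Omega>. dist x z < \<delta>}"

section \<open>Spaces of functions on the transformed cells\<close>

text \<open>The Bochner spaces over the fixed cell are identified with spaces of jointly measurable
  functions on \<open>\<Omega> \<times> Y\<^sup>*\<close>. The spaces over the varying cells consist of the functions
  \<open>(x, y) \<mapsto> f (x, \<psi>0\<^sup>-\<^sup>1(x, y))\<close>; finiteness of their norms on \<open>Q\<close> is part of the
  definition. Elements of the quotient by functions of \<open>x\<close> are given by representatives; only
  their \<open>y\<close>-gradients enter below.\<close>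

definition L2_H1_per ::
    "(real^'n) set \<Rightarrow> (real^'n) set
      \<Rightarrow> ((real^'n) \<times> (real^'n) \<Rightarrow> real) \<Rightarrow> ((real^'n) \<times> (real^'n) \<Rightarrow> real^'n) \<Rightarrow> bool" where
  "L2_H1_per \<Omega> Ystar f Df \<longleftrightarrow>
     lp_space (\<Omega> \<times> Ystar) 2 f \<and> lp_space (\<Omega> \<times> Ystar) 2 Df \<and>
     (AE x in lebesgue_on \<Omega>. H1_per Ystar (\<lambda>y. f (x, y)) (\<lambda>y. Df (x, y)))"

definition pulled_back ::
    "(real^'n) set \<Rightarrow> (real^'n) set \<Rightarrow> (real^'n \<Rightarrow> real^'n \<Rightarrow> real^'n)
      \<Rightarrow> ((real^'n) \<times> (real^'n) \<Rightarrow> real) \<Rightarrow> ((real^'n) \<times> (real^'n) \<Rightarrow> real) \<Rightarrow> bool" where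
  "pulled_back \<Omega> Ystar \<psi>0 u f \<longleftrightarrow>
     (AE (x, y) in lebesgue_on (Qset \<Omega> Ystar \<psi>0).
        u (x, y) = f (x, inv_into (closure Ystar) (\<psi>0 x) y))"

definition L2_L2_Yx ::
    "(real^'n) set \<Rightarrow> (real^'n) set \<Rightarrow> (real^'n \<Rightarrow> real^'n \<Rightarrow> real^'n)
      \<Rightarrow> ((real^'n) \<times> (real^'n) \<Rightarrow> real) \<Rightarrow> bool" where
  "L2_L2_Yx \<Omega> Ystar \<psi>0 u \<longleftrightarrow>
     (\<exists>f. lp_space (\<Omega> \<times> Ystar) 2 f \<and> pulled_back \<Omega> Ystar \<psi>0 u f) \<and>
     lp_space (Qset \<Omega> Ystar \<psi>0) 2 u"

definition L2_H1_per_Yx ::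
    "(real^'n) set \<Rightarrow> (real^'n) set \<Rightarrow> (real^'n \<Rightarrow> real^'n \<Rightarrow> real^'n)
      \<Rightarrow> ((real^'n) \<times> (real^'n) \<Rightarrow> real) \<Rightarrow> ((real^'n) \<times> (real^'n) \<Rightarrow> real^'n) \<Rightarrow> bool" where
  "L2_H1_per_Yx \<Omega> Ystar \<psi>0 u Du \<longleftrightarrow>
     (\<exists>f Df. L2_H1_per \<Omega> Ystar f Df \<and> pulled_back \<Omega> Ystar \<psi>0 u f) \<and>
     lp_space (Qset \<Omega> Ystar \<psi>0) 2 u \<and> lp_space (Qset \<Omega> Ystar \<psi>0) 2 Du \<and>
     (AE x in lebesgue_on \<Omega>.
        has_weak_gradient (\<lambda>y. u (x, y)) (\<lambda>y. Du (x, y)) (Yx Ystar \<psi>0 x))"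

section \<open>Coefficients and limit problems\<close>

definition admissible_coefficients ::
    "(nat \<Rightarrow> (real^'n) set) \<Rightarrow> (nat \<Rightarrow> real^'n \<Rightarrow> real^'n^'n) \<Rightarrow> bool" where
  "admissible_coefficients \<Omega>\<epsilon> A \<longleftrightarrow>
     (\<forall>n. A n \<in> borel_measurable (lebesgue_on (\<Omega>\<epsilon> n))) \<and>
     (\<exists>C. \<forall>n. AE x in lebesgue_on (\<Omega>\<epsilon> n). norm (A n x) \<le> C) \<and>
     (\<exists>\<alpha>>0. \<forall>n. AE x in lebesgue_on (\<Omega>\<epsilon> n). \<forall>\<xi>. \<xi> \<bullet> (A n x *v \<xi>) \<ge> \<alpha> * (norm \<xi>)\<^sup>2)"

definition coercive_on :: "'a::euclidean_space set \<Rightarrow> ('a \<Rightarrow> real^'n^'n) \<Rightarrow> bool" where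
  "coercive_on S A \<longleftrightarrow>
     (\<exists>\<alpha>>0. AE z in lebesgue_on S. \<forall>\<xi>. \<xi> \<bullet> (A z *v \<xi>) \<ge> \<alpha> * (norm \<xi>)\<^sup>2)"

definition two_scale_solution ::
    "(real^'n) set \<Rightarrow> (real^'n) set \<Rightarrow> (real^'n \<Rightarrow> real^'n \<Rightarrow> real^'n)
      \<Rightarrow> ((real^'n) \<times> (real^'n) \<Rightarrow> real^'n^'n) \<Rightarrow> ((real^'n) \<times> (real^'n) \<Rightarrow> real)
      \<Rightarrow> (real^'n \<Rightarrow> real) \<Rightarrow> (real^'n \<Rightarrow> real^'n)
      \<Rightarrow> ((real^'n) \<times> (real^'n) \<Rightarrow> real) \<Rightarrow> ((real^'n) \<times> (real^'n) \<Rightarrow> real^'n) \<Rightarrow> bool" where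
  "two_scale_solution \<Omega> Ystar \<psi>0 A0 f0 u0 Du0 u1 Du1 \<longleftrightarrow>
     H1 \<Omega> u0 Du0 \<and> L2_H1_per_Yx \<Omega> Ystar \<psi>0 u1 Du1 \<and>
     (\<forall>\<phi>0 D\<phi>0 \<phi>1 D\<phi>1. H1 \<Omega> \<phi>0 D\<phi>0 \<and> L2_H1_per_Yx \<Omega> Ystar \<psi>0 \<phi>1 D\<phi>1 \<longrightarrow>
        (LINT x|lebesgue_on \<Omega>. LINT y|lebesgue_on (Yx Ystar \<psi>0 x).
            (A0 (x, y) *v (Du0 x + Du1 (x, y))) \<bullet> (D\<phi>0 x + D\<phi>1 (x, y)) + u0 x * \<phi>0 x) =
        (LINT x|lebesgue_on \<Omega>. (LINT y|lebesgue_on (Yx Ystar \<psi>0 x). f0 (x, y)) * \<phi>0 x))"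

text \<open>The cell problems and the homogenised matrix carry the coefficient \<open>A0\<close> of the two-scale
  problem, as the elimination of \<open>u1 = (\<Sum>j. w j \<partial>\<^sub>j u0)\<close> requires. For
  \<open>A0 = mat 1\<close> they read \<open>\<integral>\<integral> (\<nabla>w\<^sub>j + e\<^sub>j) \<bullet> \<nabla>\<phi> = 0\<close>
  and \<open>B\<^sub>i\<^sub>j = \<integral> \<delta>\<^sub>i\<^sub>j + \<partial>\<^sub>i w\<^sub>j\<close>; without \<open>A0\<close> the homogenised equation fails already for
  \<open>A0 = 2 mat 1\<close> on the full cell.\<close>

definition cell_solution ::
    "(real^'n) set \<Rightarrow> (real^'n) set \<Rightarrow> (real^'n \<Rightarrow> real^'n \<Rightarrow> real^'n)
      \<Rightarrow> ((real^'n) \<times> (real^'n) \<Rightarrow> real^'n^'n) \<Rightarrow> 'n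
      \<Rightarrow> ((real^'n) \<times> (real^'n) \<Rightarrow> real) \<Rightarrow> ((real^'n) \<times> (real^'n) \<Rightarrow> real^'n) \<Rightarrow> bool" where
  "cell_solution \<Omega> Ystar \<psi>0 A0 j w Dw \<longleftrightarrow>
     L2_H1_per_Yx \<Omega> Ystar \<psi>0 w Dw \<and>
     (\<forall>\<phi> D\<phi>. L2_H1_per_Yx \<Omega> Ystar \<psi>0 \<phi> D\<phi> \<longrightarrow>
        (LINT x|lebesgue_on \<Omega>. LINT y|lebesgue_on (Yx Ystar \<psi>0 x).
            (A0 (x, y) *v (Dw (x, y) + axis j 1)) \<bullet> D\<phi> (x, y)) = 0)"

definition homogenised_matrix ::
    "(real^'n) set \<Rightarrow> (real^'n \<Rightarrow> real^'n \<Rightarrow> real^'n) \<Rightarrow> ((real^'n) \<times> (real^'n) \<Rightarrow> real^'n^'n)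
      \<Rightarrow> ('n \<Rightarrow> (real^'n) \<times> (real^'n) \<Rightarrow> real^'n) \<Rightarrow> real^'n \<Rightarrow> real^'n^'n" where
  "homogenised_matrix Ystar \<psi>0 A0 Dw x =
     (\<chi> i j. LINT y|lebesgue_on (Yx Ystar \<psi>0 x). (A0 (x, y) *v (axis j 1 + Dw j (x, y))) $ i)"

definition porosity ::
    "(real^'n) set \<Rightarrow> (real^'n \<Rightarrow> real^'n \<Rightarrow> real^'n) \<Rightarrow> real^'n \<Rightarrow> real" where
  "porosity Ystar \<psi>0 x = (LINT y|lebesgue_on (Yx Ystar \<psi>0 x). 1)"

end

theory Submission
  imports Defs
begin

text \<open>
  The homogenised equation is the two-scale equation tested with \<open>\<phi>1 = 0\<close>. What has to be shown is
  that the flux \<open>A0 (\<nabla>u0 + \<nabla>\<^sub>y u1)\<close>, integrated over the cell at \<open>x\<close>, equals \<open>B0(x) \<nabla>u0(x)\<close>; this is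
  the classical elimination \<open>\<nabla>\<^sub>y u1 = (\<Sum>j. \<partial>\<^sub>j u0 \<nabla>\<^sub>y w\<^sub>j)\<close>.

  The elimination is usually obtained from uniqueness: \<open>(\<Sum>j. w\<^sub>j \<partial>\<^sub>j u0)\<close> solves the same problem as
  \<open>u1\<close>. As a representative this sum may fail to be square integrable, since only
  the gradients of the \<open>w\<^sub>j\<close> are bounded over the cells. The argument here works on the single cells
  instead. The test space is stable under multiplication by a bounded measurable function \<open>c(x)\<close> of
  the slow variable, \<open>L2_H1_per_Yx_scale\<close>. Choosing \<open>c\<close> as the sign of a cell integral turns each
  global identity into one that holds on almost every cell, \<open>fibrewise_orthogonality\<close>.
  Applied to the test functions \<open>u1\<close> and \<open>w\<^sub>i\<close> only, this says that on almost every cell the fluxes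
  \<open>A0 (\<nabla>u0 + \<nabla>\<^sub>y u1)\<close> and \<open>A0 (e\<^sub>j + \<nabla>\<^sub>y w\<^sub>j)\<close> are orthogonal to \<open>\<nabla>\<^sub>y u1\<close> and to all \<open>\<nabla>\<^sub>y w\<^sub>i\<close>, where
  \<open>\<nabla>u0(x)\<close> is now a constant vector. Coercivity then forces the difference
  \<open>\<nabla>\<^sub>y u1 - (\<Sum>j. \<partial>\<^sub>j u0 \<nabla>\<^sub>y w\<^sub>j)\<close> to vanish, \<open>coercive_superposition\<close>. The same cell identities
  give the energy estimate for \<open>\<nabla>\<^sub>y w\<^sub>j\<close> that bounds \<open>B0\<close>, \<open>corrector_energy_bound\<close>.

  All of this needs Fubini on the noncylindrical set \<open>Q\<close>, hence its Lebesgue measurability. It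
  holds because \<open>\<psi>0\<close> is measurable in \<open>x\<close> and continuous in \<open>y\<close>, which allows \<open>Q\<close> to be written
  with countably many set operations up to a null set, \<open>sets_lebesgue_Qset\<close>.
\<close>

section \<open>Sections of Lebesgue measurable sets and functions\<close>

text \<open>The Lebesgue measure on a product is the completion of the product of the Borel measures and
  not a product measure itself. Tonelli and Fubini are therefore carried over from Borel
  representatives, with the exceptional null sets handled separately.\<close>

lemma AE_lebesgue_sections:
  fixes P :: "'a::euclidean_space \<times> 'b::euclidean_space \<Rightarrow> bool"
  assumes "AE z in lebesgue. P z"
  shows "AE x in lebesgue. AE y in lebesgue. P (x, y)"
proof -
  have "AE z in lborel \<Otimes>\<^sub>M lborel. P z"
    using assms unfolding AE_completion_iff lborel_prod .
  then show ?thesis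
    using lborel_pair.AE_pair by (simp add: AE_completion_iff)
qed

lemma null_sets_lborel_Times_UNIV:
  fixes N :: "'a::euclidean_space set"
  assumes "N \<in> null_sets lborel"
  shows "N \<times> (UNIV :: 'b::euclidean_space set) \<in> null_sets lborel"
  using lborel.times_in_null_sets1[OF assms, of "UNIV :: 'b set"] by (simp add: lborel_prod)

text \<open>For Lebesgue sets in the codomain, measurability of the projection is more than continuity:
  preimages of null sets have to be null.\<close>

lemma measurable_fst_lebesgue:
  "fst \<in> (lebesgue :: ('a::euclidean_space \<times> 'b::euclidean_space) measure) \<rightarrow>\<^sub>M (lebesgue :: 'a measure)"
proof (rule completion.measurable_completion2)
  show fst: "fst \<in> (lebesgue :: ('a \<times> 'b) measure) \<rightarrow>\<^sub>M (lborel :: 'a measure)"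
    by (rule measurable_completion) (use measurable_fst[of lborel lborel] in \<open>simp only: lborel_prod\<close>)
  show "null_sets (lborel :: 'a measure) \<subseteq> null_sets (distr (lebesgue :: ('a \<times> 'b) measure) lborel fst)"
  proof
    fix N :: "'a set" assume N: "N \<in> null_sets lborel"
    have "fst -` N \<inter> space (lebesgue :: ('a \<times> 'b) measure) = N \<times> UNIV"
      by auto
    then show "N \<in> null_sets (distr (lebesgue :: ('a \<times> 'b) measure) lborel fst)"
      using null_sets_lborel_Times_UNIV[OF N, where 'b='b] null_setsD2[OF N]
      by (simp add: null_sets_distr_iff[OF fst] null_sets_completionI)
  qed
qed

lemma AE_lebesgue_fst:
  fixes P :: "'a::euclidean_space \<Rightarrow> bool"
  assumes "AE x in lebesgue. P x"
  shows "AE z in (lebesgue :: ('a \<times> 'b::euclidean_space) measure). P (fst z)"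
proof -
  from assms obtain N where N: "N \<in> null_sets lborel" "{x. \<not> P x} \<subseteq> N"
    unfolding AE_completion_iff by (auto simp: eventually_ae_filter)
  have "AE z in (lborel :: ('a \<times> 'b) measure). P (fst z)"
    by (rule AE_I'[OF null_sets_lborel_Times_UNIV[OF N(1)]]) (use N(2) in auto)
  then show ?thesis
    by (rule AE_completion)
qed

lemma AE_sets_lebesgue_section:
  fixes Q :: "('a::euclidean_space \<times> 'b::euclidean_space) set"
  assumes "Q \<in> sets lebesgue"
  shows "AE x in lebesgue. {y. (x, y) \<in> Q} \<in> sets lebesgue"
proof -
  define Q' where "Q' = main_part lborel Q"
  have Q': "Q' \<in> sets lborel"
    unfolding Q'_def using assms by (rule main_part_sets)
  have "AE z in lebesgue. z \<in> Q \<longleftrightarrow> z \<in> Q'"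
    using AE_completion[OF AE_notin_null_part[OF assms]]
    by eventually_elim (use main_part_null_part_Un[OF assms] in \<open>auto simp: Q'_def\<close>)
  from AE_lebesgue_sections[OF this] show ?thesis
  proof eventually_elim
    case (elim x)
    have "Pair x -` Q' \<in> sets borel"
      using sets_Pair1[of Q' lborel lborel x] Q' unfolding lborel_prod by simp
    then have "Pair x -` Q' \<in> sets lebesgue"
      by auto
    moreover have "AE y in lebesgue. y \<in> Pair x -` Q' \<longleftrightarrow> y \<in> {y. (x, y) \<in> Q}"
      using elim by eventually_elim auto
    ultimately show ?case
      by (intro completion.in_sets_AE[where A="Pair x -` Q'" and B="{y. (x, y) \<in> Q}" and M=lborel]) simp_all
  qed
qed

lemma integrable_lebesgue_sections:
  fixes f :: "'a::euclidean_space \<times> 'b::euclidean_space \<Rightarrow> real"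
  assumes "integrable lebesgue f"
  shows "AE x in lebesgue. integrable lebesgue (\<lambda>y. f (x, y))" (is ?fibres)
    and "integrable lebesgue (\<lambda>x. LINT y|lebesgue. f (x, y))" (is ?marginal)
proof -
  obtain g where g: "g \<in> borel_measurable lborel" and fg: "AE z in lborel. f z = g z"
    using completion_ex_borel_measurable_real[OF borel_measurable_integrable[OF assms]] by blast
  have "integrable lebesgue g"
    by (rule integrable_cong_AE_imp[OF assms measurable_completion[OF g] AE_completion[OF fg]])
  then have "integrable lborel g"
    using g by (simp add: integrable_completion)
  then have g_int: "integrable (lborel \<Otimes>\<^sub>M lborel) g"
    unfolding lborel_prod .
  have g_meas: "(\<lambda>y. g (x, y)) \<in> borel_measurable lborel" for x
    using measurable_compose[OF measurable_Pair1' g[folded lborel_prod]] by simp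
  have fg_sect: "AE x in lebesgue. AE y in lebesgue. f (x, y) = g (x, y)"
    using AE_lebesgue_sections[OF AE_completion[OF fg]] .
  have f_meas: "(\<lambda>y. f (x, y)) \<in> borel_measurable lebesgue"
    if "AE y in lebesgue. f (x, y) = g (x, y)" for x
  proof (rule borel_measurable_AE[OF measurable_completion[OF g_meas[of x]]])
    show "AE y in lebesgue. g (x, y) = f (x, y)"
      using that by eventually_elim simp
  qed
  show ?fibres
    using fg_sect AE_completion[OF lborel_pair.AE_integrable_fst'[OF g_int]]
  proof eventually_elim
    case (elim x)
    then have "integrable lebesgue (\<lambda>y. g (x, y))"
      using g_meas by (simp add: integrable_completion)
    moreover have "AE y in lebesgue. g (x, y) = f (x, y)"
      using elim(1) by eventually_elim simp
    ultimately show ?case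
      using f_meas[OF elim(1)] integrable_cong_AE_imp by blast
  qed
  have marginal_g: "integrable lebesgue (\<lambda>x. LINT y|lborel. g (x, y))"
    using lborel_pair.integrable_fst'[OF g_int]
    using integrable_completion borel_measurable_integrable by blast
  have marg_eq: "AE x in lebesgue. (LINT y|lebesgue. f (x, y)) = (LINT y|lborel. g (x, y))"
    using fg_sect
  proof eventually_elim
    case (elim x)
    have "(LINT y|lebesgue. f (x, y)) = (LINT y|lebesgue. g (x, y))"
      using elim by (intro integral_cong_AE f_meas measurable_completion g_meas)
    then show ?case
      by (simp add: integral_completion[OF g_meas])
  qed
  moreover have "(\<lambda>x. LINT y|lebesgue. f (x, y)) \<in> borel_measurable lebesgue"
  proof (rule borel_measurable_AE[OF borel_measurable_integrable[OF marginal_g]])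
    show "AE x in lebesgue. (LINT y|lborel. g (x, y)) = (LINT y|lebesgue. f (x, y))"
      using marg_eq by eventually_elim simp
  qed
  moreover have "AE x in lebesgue. (LINT y|lborel. g (x, y)) = (LINT y|lebesgue. f (x, y))"
    using marg_eq by eventually_elim simp
  ultimately show ?marginal
    using integrable_cong_AE_imp[OF marginal_g] by blast
qed

section \<open>Families of cells\<close>

text \<open>The cells are sections of \<open>Q\<close> only for almost every \<open>x\<close>, because a limit transformation is
  unrestricted on a null set of \<open>x\<close>. The common box \<open>B\<close> bounds the measure of the cells, so that
  functions integrable on the base remain integrable when lifted to \<open>Q\<close>.\<close>

locale cell_family =
  fixes \<Omega> :: "'a::euclidean_space set" and Y :: "'a \<Rightarrow> 'b::euclidean_space set"
    and Q :: "('a \<times> 'b) set" and B :: "'b set"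
  assumes base: "\<Omega> \<in> sets lebesgue" and total: "Q \<in> sets lebesgue"
    and fibres: "AE x in lebesgue_on \<Omega>. Y x = {y. (x, y) \<in> Q}"
    and bounded_box: "Q \<subseteq> \<Omega> \<times> B" "B \<in> fmeasurable lborel"
begin

lemma AE_base_iff: "(AE x in lebesgue_on \<Omega>. P x) \<longleftrightarrow> (AE x in lebesgue. x \<in> \<Omega> \<longrightarrow> P x)"
  using base by (intro AE_restrict_space_iff) auto

lemma AE_total_iff: "(AE z in lebesgue_on Q. P z) \<longleftrightarrow> (AE z in lebesgue. z \<in> Q \<longrightarrow> P z)"
  using total by (intro AE_restrict_space_iff) auto

lemma AE_sets_fibre: "AE x in lebesgue_on \<Omega>. Y x \<in> sets lebesgue"
  using fibres AE_sets_lebesgue_section[OF total] unfolding AE_base_iff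
  by eventually_elim auto

lemma lmeasurable_box: "B \<in> lmeasurable"
  using bounded_box(2) by (simp add: fmeasurable_def)

lemma AE_fibre_subset: "AE x in lebesgue_on \<Omega>. Y x \<subseteq> B"
  using fibres by eventually_elim (use bounded_box in auto)

lemma AE_finite_fibre: "AE x in lebesgue_on \<Omega>. finite_measure (lebesgue_on (Y x)) \<and>
    measure (lebesgue_on (Y x)) (Y x) \<le> measure lebesgue B"
  using AE_sets_fibre AE_fibre_subset
proof eventually_elim
  case (elim x)
  then have "Y x \<in> lmeasurable"
    using lmeasurable_box fmeasurableI2 by blast
  then show ?case
    using elim lmeasurable_box
    by (auto intro!: finite_measure_lebesgue_on measure_mono_fmeasurable simp: measure_restrict_space)
qed

lemma AE_fibres:
  assumes "AE z in lebesgue_on Q. P z"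
  shows "AE x in lebesgue_on \<Omega>. AE y in lebesgue_on (Y x). P (x, y)"
  using AE_lebesgue_sections[OF assms[unfolded AE_total_iff]] AE_sets_fibre fibres
  unfolding AE_base_iff
proof eventually_elim
  case (elim x)
  then have "AE y in lebesgue. y \<in> Y x \<longrightarrow> P (x, y)" if "x \<in> \<Omega>"
    using that by auto
  then show ?case
    using elim by (auto simp: AE_restrict_space_iff)
qed

lemma measurable_from_base:
  fixes c :: "'a \<Rightarrow> 'c::euclidean_space"
  assumes "c \<in> borel_measurable (lebesgue_on \<Omega>)"
  shows "(\<lambda>z. c (fst z)) \<in> borel_measurable (lebesgue_on Q)"
proof -
  have "(\<lambda>x. if x \<in> \<Omega> then c x else 0) \<in> borel_measurable lebesgue"
    using borel_measurable_if_I[OF assms base] .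
  then have "(\<lambda>z. if fst z \<in> \<Omega> then c (fst z) else 0) \<in> borel_measurable (lebesgue :: ('a \<times> 'b) measure)"
    using measurable_compose[OF measurable_fst_lebesgue] by blast
  then have "(\<lambda>z. if fst z \<in> \<Omega> then c (fst z) else 0) \<in> borel_measurable (lebesgue_on Q)"
    by (rule measurable_restrict_space1)
  then show ?thesis
    using bounded_box(1) by (subst measurable_cong[where g="\<lambda>z. if fst z \<in> \<Omega> then c (fst z) else 0"]) auto
qed

text \<open>On the cylinder \<open>\<Omega> \<times> B\<close>, which contains \<open>Q\<close>, Tonelli gives the \<open>L\<^sup>1\<close> norm of the lifted
  function as the \<open>L\<^sup>1\<close> norm on the base times the measure of \<open>B\<close>.\<close>

lemma integrable_from_base:
  fixes g :: "'a \<Rightarrow> real"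
  assumes "integrable (lebesgue_on \<Omega>) g"
  shows "integrable (lebesgue_on Q) (\<lambda>z. g (fst z))"
proof -
  have "integrable lebesgue (\<lambda>x. indicator \<Omega> x *\<^sub>R g x)"
    using assms base by (simp add: integrable_restrict_space)
  then have fin: "(\<integral>\<^sup>+x. norm (indicator \<Omega> x *\<^sub>R g x) \<partial>lebesgue) < \<infinity>"
    and meas: "(\<lambda>x. indicator \<Omega> x *\<^sub>R g x) \<in> borel_measurable lebesgue"
    unfolding integrable_iff_bounded by auto
  from meas obtain h where h: "h \<in> borel_measurable lborel" "AE x in lborel. indicator \<Omega> x *\<^sub>R g x = h x"
    using completion_ex_borel_measurable_real by blast
  have B: "B \<in> sets borel" "emeasure lborel B < \<infinity>"
    using bounded_box(2) by (auto simp: fmeasurable_def)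
  have fst_snd: "fst \<in> borel_measurable (lborel :: ('a \<times> 'b) measure)"
      "snd \<in> borel_measurable (lborel :: ('a \<times> 'b) measure)"
    by (simp_all add: borel_measurable_continuous_onI continuous_on_fst continuous_on_snd)
  define H where "H z = ennreal (norm (h (fst z))) * indicator B (snd z)" for z :: "'a \<times> 'b"
  have H_meas: "H \<in> borel_measurable lborel"
    unfolding H_def using h(1) B(1) fst_snd measurable_compose[OF fst_snd(1), of h]
      measurable_compose[OF fst_snd(2), of "indicator B :: _ \<Rightarrow> ennreal"]
    by (auto intro!: borel_measurable_times_ennreal)
  have "AE x in lebesgue. indicator \<Omega> x *\<^sub>R g x = h x"
    using h(2) by (rule AE_completion)
  from AE_lebesgue_fst[OF this, where 'b='b]
  have dom: "AE z in lebesgue. ennreal (norm (g (fst z))) * indicator Q z \<le> H z"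
  proof eventually_elim
    case (elim z)
    show ?case
    proof (cases "z \<in> Q")
      case True
      then have "fst z \<in> \<Omega>" "snd z \<in> B"
        using bounded_box(1) by auto
      then show ?thesis
        using elim True by (simp add: H_def)
    qed simp
  qed
  have "(\<integral>\<^sup>+z. norm (g (fst z)) \<partial>lebesgue_on Q) =
      (\<integral>\<^sup>+z. ennreal (norm (g (fst z))) * indicator Q z \<partial>lebesgue)"
    using total by (simp add: nn_integral_restrict_space)
  also have "\<dots> \<le> (\<integral>\<^sup>+z. H z \<partial>lebesgue)"
    using dom by (rule nn_integral_mono_AE)
  also have "\<dots> = (\<integral>\<^sup>+z. H z \<partial>(lborel \<Otimes>\<^sub>M lborel))"
    by (simp only: nn_integral_completion lborel_prod)
  also have "\<dots> = (\<integral>\<^sup>+x. (\<integral>\<^sup>+y. H (x, y) \<partial>lborel) \<partial>lborel)"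
    using H_meas by (intro lborel.nn_integral_fst[symmetric]) (simp only: lborel_prod)
  also have "\<dots> = (\<integral>\<^sup>+x. ennreal (norm (h x)) * emeasure lborel B \<partial>lborel)"
    unfolding H_def using B(1) by (simp add: nn_integral_cmult_indicator)
  also have "\<dots> = (\<integral>\<^sup>+x. ennreal (norm (h x)) \<partial>lborel) * emeasure lborel B"
    using h(1) by (intro nn_integral_multc) auto
  also have "(\<integral>\<^sup>+x. ennreal (norm (h x)) \<partial>lborel) = (\<integral>\<^sup>+x. norm (indicator \<Omega> x *\<^sub>R g x) \<partial>lebesgue)"
    unfolding nn_integral_completion using h(2) by (intro nn_integral_cong_AE) auto
  also have "\<dots> * emeasure lborel B < \<infinity>"
    using fin B(2) by (simp add: ennreal_mult_less_top)
  finally show ?thesis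
    using measurable_from_base[OF borel_measurable_integrable[OF assms]]
    by (auto simp: integrable_iff_bounded)
qed

lemma integrable_fibres:
  fixes g :: "'a \<times> 'b \<Rightarrow> real"
  assumes "integrable (lebesgue_on Q) g"
  shows "AE x in lebesgue_on \<Omega>. integrable (lebesgue_on (Y x)) (\<lambda>y. g (x, y))" (is ?fib)
    and "integrable (lebesgue_on \<Omega>) (\<lambda>x. LINT y|lebesgue_on (Y x). g (x, y))" (is ?marg)
proof -
  define h where "h z = indicator Q z *\<^sub>R g z" for z
  have h: "integrable lebesgue h"
    using assms total unfolding h_def by (simp add: integrable_restrict_space)
  have h_fib: "AE x in lebesgue. x \<in> \<Omega> \<longrightarrow> (\<forall>y. h (x, y) = indicator (Y x) y *\<^sub>R g (x, y))"
    using fibres unfolding AE_base_iff h_def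
    by eventually_elim (auto simp: indicator_def)
  show ?fib
    using h_fib integrable_lebesgue_sections(1)[OF h] AE_sets_fibre
    unfolding AE_base_iff by eventually_elim (auto simp: integrable_restrict_space)
  have eq: "AE x in lebesgue_on \<Omega>. (LINT y|lebesgue. h (x, y)) = (LINT y|lebesgue_on (Y x). g (x, y))"
    using h_fib AE_sets_fibre
    unfolding AE_base_iff by eventually_elim (auto simp: integral_restrict_space)
  have sect: "integrable (lebesgue_on \<Omega>) (\<lambda>x. LINT y|lebesgue. h (x, y))"
    using integrable_mult_indicator[OF base integrable_lebesgue_sections(2)[OF h]] base
    by (simp add: integrable_restrict_space)
  let ?m = "\<lambda>x. LINT y|lebesgue_on (Y x). g (x, y)"
  have "AE x in lebesgue. (if x \<in> \<Omega> then LINT y|lebesgue. h (x, y) else 0) = (if x \<in> \<Omega> then ?m x else 0)"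
    using eq unfolding AE_base_iff by eventually_elim auto
  then have "(\<lambda>x. if x \<in> \<Omega> then ?m x else 0) \<in> borel_measurable lebesgue"
    by (rule borel_measurable_AE[OF borel_measurable_if_I[OF borel_measurable_integrable[OF sect] base]])
  then have "?m \<in> borel_measurable (lebesgue_on \<Omega>)"
    by (rule borel_measurable_if_D)
  then show ?marg
    using integrable_cong_AE_imp[OF sect] eq by blast
qed

end

section \<open>Square integrable fields\<close>

lemma lp_space_2_iff:
  "lp_space S 2 f \<longleftrightarrow> f \<in> borel_measurable (lebesgue_on S) \<and>
     integrable (lebesgue_on S) (\<lambda>x. (norm (f x))\<^sup>2)"
  by (simp add: lp_space_def)

lemma lp_space_2_add:
  assumes "lp_space S 2 f" "lp_space S 2 g"
  shows "lp_space S 2 (\<lambda>x. f x + g x)"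
proof -
  have [measurable]: "f \<in> borel_measurable (lebesgue_on S)" "g \<in> borel_measurable (lebesgue_on S)"
    using assms by (auto simp: lp_space_2_iff)
  have "integrable (lebesgue_on S) (\<lambda>x. (norm (f x + g x))\<^sup>2)"
  proof (rule Bochner_Integration.integrable_bound)
    show "integrable (lebesgue_on S) (\<lambda>x. 2 * (norm (f x))\<^sup>2 + 2 * (norm (g x))\<^sup>2)"
      using assms by (simp add: lp_space_2_iff)
    have "(norm (f x + g x))\<^sup>2 \<le> 2 * (norm (f x))\<^sup>2 + 2 * (norm (g x))\<^sup>2" for x
    proof -
      have "(norm (f x + g x))\<^sup>2 \<le> (norm (f x) + norm (g x))\<^sup>2"
        by (intro power_mono norm_triangle_ineq) simp
      also have "\<dots> \<le> 2 * (norm (f x))\<^sup>2 + 2 * (norm (g x))\<^sup>2"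
        using zero_le_power2[of "norm (f x) - norm (g x)"] by (simp add: power2_eq_square algebra_simps)
      finally show ?thesis .
    qed
    then show "AE x in lebesgue_on S. norm ((norm (f x + g x))\<^sup>2) \<le> norm (2 * (norm (f x))\<^sup>2 + 2 * (norm (g x))\<^sup>2)"
      by simp
  qed measurable
  then show ?thesis
    using assms by (simp add: lp_space_2_iff)
qed

lemma integrable_inner_lp_space_2:
  assumes "lp_space S 2 f" "lp_space S 2 g"
  shows "integrable (lebesgue_on S) (\<lambda>x. f x \<bullet> g x)"
proof (rule Bochner_Integration.integrable_bound)
  show "integrable (lebesgue_on S) (\<lambda>x. (norm (f x))\<^sup>2 + (norm (g x))\<^sup>2)"
    using assms by (simp add: lp_space_2_iff)
  have "\<bar>f x \<bullet> g x\<bar> \<le> (norm (f x))\<^sup>2 + (norm (g x))\<^sup>2" for x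
  proof -
    have "\<bar>f x \<bullet> g x\<bar> \<le> norm (f x) * norm (g x)"
      by (rule Cauchy_Schwarz_ineq2)
    also have "\<dots> \<le> (norm (f x))\<^sup>2 + (norm (g x))\<^sup>2"
      using zero_le_power2[of "norm (f x) - norm (g x)"] zero_le_power2[of "norm (f x)"]
        zero_le_power2[of "norm (g x)"] unfolding power2_diff by linarith
    finally show ?thesis .
  qed
  then show "AE x in lebesgue_on S. norm (f x \<bullet> g x) \<le> norm ((norm (f x))\<^sup>2 + (norm (g x))\<^sup>2)"
    by simp
qed (use assms in \<open>auto simp: lp_space_2_iff intro!: borel_measurable_inner\<close>)

lemma lp_space_2_scaleR:
  assumes "lp_space S 2 f" "c \<in> borel_measurable (lebesgue_on S)" "\<And>x. \<bar>c x\<bar> \<le> K"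
  shows "lp_space S 2 (\<lambda>x. c x *\<^sub>R f x)"
proof -
  have [measurable]: "f \<in> borel_measurable (lebesgue_on S)" "c \<in> borel_measurable (lebesgue_on S)"
    using assms by (auto simp: lp_space_2_iff)
  have "integrable (lebesgue_on S) (\<lambda>x. (norm (c x *\<^sub>R f x))\<^sup>2)"
  proof (rule Bochner_Integration.integrable_bound)
    show "integrable (lebesgue_on S) (\<lambda>x. K\<^sup>2 * (norm (f x))\<^sup>2)"
      using assms by (simp add: lp_space_2_iff)
    have "(norm (c x *\<^sub>R f x))\<^sup>2 \<le> K\<^sup>2 * (norm (f x))\<^sup>2" for x
      using power_mono[OF assms(3), of x 2] by (simp add: power_mult_distrib mult_right_mono)
    then show "AE x in lebesgue_on S. norm ((norm (c x *\<^sub>R f x))\<^sup>2) \<le> norm (K\<^sup>2 * (norm (f x))\<^sup>2)"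
      by simp
  qed measurable
  then show ?thesis
    using assms by (simp add: lp_space_2_iff)
qed

lemma lp_space_2_scale_const:
  fixes f :: "'a::euclidean_space \<Rightarrow> 'b::euclidean_space"
  shows "lp_space S 2 f \<Longrightarrow> lp_space S 2 (\<lambda>x. c *\<^sub>R f x)"
  using lp_space_2_scaleR[of S f "\<lambda>_. c" "\<bar>c\<bar>"] by simp

text \<open>The norm on matrices is the Frobenius norm, which dominates the operator norm by Cauchy-Schwarz
  in each row.\<close>

lemma norm_matrix_vector_mult_le: "norm (A *v x) \<le> norm A * norm x" for A :: "real^'n^'m"
proof -
  have "norm ((A *v x) $ i) \<le> norm (A $ i) * norm x" for i
    using Cauchy_Schwarz_ineq2[of "A $ i" x] by (simp add: matrix_vector_mult_def inner_vec_def)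
  then have "norm (A *v x) \<le> L2_set (\<lambda>i. norm (A $ i) * norm x) UNIV"
    unfolding norm_vec_def[of "A *v x"] by (intro L2_set_mono) auto
  then show ?thesis
    by (simp add: L2_set_left_distrib norm_vec_def[of A])
qed

lemma norm_matrix_le:
  fixes B :: "real^'n^'m"
  assumes "\<And>i j. \<bar>B $ i $ j\<bar> \<le> c"
  shows "norm B \<le> real CARD('m) * (real CARD('n) * c)"
proof -
  have "norm B \<le> (\<Sum>i\<in>UNIV. norm (B $ i))"
    unfolding norm_vec_def[of B] by (rule L2_set_le_sum) simp
  also have "\<dots> \<le> (\<Sum>i\<in>UNIV. \<Sum>j\<in>UNIV. \<bar>B $ i $ j\<bar>)"
    by (intro sum_mono norm_le_l1_cart)
  also have "\<dots> \<le> (\<Sum>i\<in>(UNIV :: 'm set). \<Sum>j\<in>(UNIV :: 'n set). c)"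
    by (intro sum_mono assms)
  finally show ?thesis by simp
qed

lemma borel_measurable_matrix:
  fixes B :: "'a \<Rightarrow> real^'n^'m"
  assumes "\<And>i j. (\<lambda>x. B x $ i $ j) \<in> borel_measurable M"
  shows "B \<in> borel_measurable M"
  using assms by (subst borel_measurable_euclidean_space) (auto simp: Basis_vec_def inner_axis)

lemma borel_measurable_matrix_vector_mult:
  fixes A :: "'a \<Rightarrow> real^'n^'m"
  assumes "A \<in> borel_measurable M" "f \<in> borel_measurable M"
  shows "(\<lambda>z. A z *v f z) \<in> borel_measurable M"
  using assms
proof (rule borel_measurable_continuous_Pair)
  show "continuous_on UNIV (\<lambda>z. fst z *v (snd z :: real^'n) :: real^'m)"
    unfolding matrix_vector_mult_def by (intro continuous_intros)
qed

lemma lp_space_2_const: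
  assumes "S \<in> lmeasurable"
  shows "lp_space S 2 (\<lambda>_. c)"
  using finite_measure.integrable_const[OF finite_measure_lebesgue_on[OF assms], of "(norm c)\<^sup>2"]
  by (simp add: lp_space_2_iff)

lemma lp_space_2_matrix_vector_mult:
  fixes A :: "'a::euclidean_space \<Rightarrow> real^'n^'m"
  assumes "linf_space S A" "lp_space S 2 f"
  shows "lp_space S 2 (\<lambda>x. A x *v f x)"
proof -
  obtain C where C: "AE x in lebesgue_on S. norm (A x) \<le> C"
    using assms(1) by (auto simp: linf_space_def)
  have meas: "(\<lambda>x. A x *v f x) \<in> borel_measurable (lebesgue_on S)"
    using assms by (intro borel_measurable_matrix_vector_mult) (auto simp: linf_space_def lp_space_2_iff)
  moreover have "integrable (lebesgue_on S) (\<lambda>x. (norm (A x *v f x))\<^sup>2)"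
  proof (rule Bochner_Integration.integrable_bound)
    show "integrable (lebesgue_on S) (\<lambda>x. C\<^sup>2 * (norm (f x))\<^sup>2)"
      using assms by (simp add: lp_space_2_iff)
    show "AE x in lebesgue_on S. norm ((norm (A x *v f x))\<^sup>2) \<le> norm (C\<^sup>2 * (norm (f x))\<^sup>2)"
      using C
    proof eventually_elim
      case (elim x)
      have "norm (A x *v f x) \<le> C * norm (f x)"
        using norm_matrix_vector_mult_le[of "A x" "f x"] mult_right_mono[OF elim norm_ge_zero[of "f x"]]
        by linarith
      from power_mono[OF this norm_ge_zero, of 2] show ?case
        by (simp add: power_mult_distrib)
    qed
  qed (use meas in simp)
  ultimately show ?thesis
    by (simp add: lp_space_2_iff)
qed

section \<open>The cells of a limit transformation\<close>

lemma Ycell_fmeasurable: "Ycell \<in> fmeasurable lborel"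
  unfolding Ycell_def by (rule fmeasurableI) (auto simp: emeasure_lborel_cbox_eq)

lemma measure_Ycell: "measure lebesgue (Ycell :: (real^'n) set) = 1"
  unfolding Ycell_def by (simp add: content_unit)

lemma cell_family_const:
  fixes \<Omega> Ystar :: "(real^'n) set"
  assumes "open \<Omega>" "open Ystar" "Ystar \<subseteq> Ycell"
  shows "cell_family \<Omega> (\<lambda>_. Ystar) (\<Omega> \<times> Ystar) Ycell"
proof
  show "\<Omega> \<in> sets lebesgue" "\<Omega> \<times> Ystar \<in> sets lebesgue"
    using assms by (auto intro!: sets_completionI_sets borel_open open_Times)
  show "AE x in lebesgue_on \<Omega>. Ystar = {y. (x, y) \<in> \<Omega> \<times> Ystar}"
    by (rule AE_I2) auto
  show "\<Omega> \<times> Ystar \<subseteq> \<Omega> \<times> Ycell" "(Ycell :: (real^'n) set) \<in> fmeasurable lborel"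
    using assms Ycell_fmeasurable by auto
qed

text \<open>The image of a compact set is the closure of the image of a dense subset. This replaces the
  union over all points of \<open>C\<close> by countable operations.\<close>

lemma compact_image_iff_countable:
  fixes f :: "'a::metric_space \<Rightarrow> 'b::metric_space"
  assumes "compact C" "D \<subseteq> C" "C \<subseteq> closure D" "continuous_on C f"
  shows "y \<in> f ` C \<longleftrightarrow> (\<forall>m. \<exists>z\<in>D. dist (f z) y < 1 / real (Suc m))"
proof -
  have C: "C = closure D"
    using assms by (simp add: closure_minimal compact_imp_closed subset_antisym)
  have "f ` C = closure (f ` D)"
  proof (rule antisym)
    show "f ` C \<subseteq> closure (f ` D)"
      using assms(4) unfolding C by (intro image_closure_subset closure_subset) auto
    show "closure (f ` D) \<subseteq> f ` C"
      using assms by (intro closure_minimal image_mono compact_imp_closed compact_continuous_image)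
  qed
  moreover have "(\<exists>z\<in>D. dist (f z) y < e)"
    if "\<forall>m. \<exists>z\<in>D. dist (f z) y < 1 / real (Suc m)" "e > 0" for e
    using that reals_Archimedean[of e] by (metis inverse_eq_divide less_trans)
  moreover have "1 / real (Suc m) > 0" for m
    by simp
  moreover have "y \<in> closure (f ` D) \<longleftrightarrow> (\<forall>e>0. \<exists>z\<in>D. dist (f z) y < e)"
    by (simp add: closure_approachable)
  ultimately show ?thesis
    by metis
qed

text \<open>Images of measurable sets need not be measurable. Here \<open>Ystar\<close> is a countable union of compact
  sets, and membership in the image of each of them is decided by countably many of the functions
  \<open>x \<mapsto> \<psi>0(x, z)\<close>, which are measurable.\<close>

lemma sets_lebesgue_Qset:
  fixes \<Omega> Ystar :: "(real^'n) set"
  assumes "open \<Omega>" "open Ystar" and trafo: "limit_transformation \<Omega> Ystar \<psi>0"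
  shows "Qset \<Omega> Ystar \<psi>0 \<in> sets lebesgue"
proof -
  have \<Omega>: "\<Omega> \<in> sets lebesgue"
    using assms(1) by (auto intro!: sets_completionI_sets)
  obtain C :: "nat \<Rightarrow> (real^'n) set" where C: "\<And>n. compact (C n)" "\<And>n. C n \<subseteq> Ystar" "\<Union>(range C) = Ystar"
  proof (rule open_Union_compact_subsets[OF assms(2)])
    fix C :: "nat \<Rightarrow> (real^'n) set"
    assume "\<And>n. compact (C n)" "\<And>n. C n \<subseteq> Ystar" "\<Union>(range C) = Ystar"
    then show thesis
      by (rule that)
  qed
  have "\<forall>n. \<exists>D. countable D \<and> D \<subseteq> C n \<and> C n \<subseteq> closure D"
    by (meson separable)
  then obtain D where D: "\<And>n. countable (D n)" "\<And>n. D n \<subseteq> C n" "\<And>n. C n \<subseteq> closure (D n)"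
    by metis
  define T where "T n m = (\<Union>z\<in>D n. {p. fst p \<in> \<Omega> \<and> dist (\<psi>0 (fst p) z) (snd p) < 1 / real (Suc m)})"
    for n m
  define S where "S = (\<Union>n. \<Inter>m. T n m)"
  have near: "{p. fst p \<in> \<Omega> \<and> dist (\<psi>0 (fst p) z) (snd p) < e} \<in> sets lebesgue" if "z \<in> D n" for n z e
  proof -
    define h where "h x = (if x \<in> \<Omega> then \<psi>0 x z else 0)" for x
    have "z \<in> closure Ystar"
      using that D(2) C(2) closure_subset by blast
    then have "(\<lambda>x. \<psi>0 x z) \<in> borel_measurable (lebesgue_on \<Omega>)"
      using trafo by (auto simp: limit_transformation_def linf_C1_def)
    then have "h \<in> borel_measurable lebesgue"
      unfolding h_def using \<Omega> by (rule borel_measurable_if_I)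
    then have h: "(\<lambda>p :: (real^'n) \<times> (real^'n). h (fst p)) \<in> borel_measurable lebesgue"
      using measurable_compose[OF measurable_fst_lebesgue] by blast
    have snd: "(snd :: (real^'n) \<times> (real^'n) \<Rightarrow> _) \<in> borel_measurable lebesgue"
      by (intro measurable_completion) (simp add: borel_measurable_continuous_onI continuous_on_snd)
    have "(\<lambda>p :: (real^'n) \<times> (real^'n). dist (h (fst p)) (snd p)) \<in> borel_measurable lebesgue"
      using h snd by (rule borel_measurable_dist)
    then have 1: "{p \<in> space lebesgue. dist (h (fst p)) (snd p) < e} \<in> sets lebesgue"
      by (rule borel_measurable_less) simp
    have 2: "fst -` \<Omega> \<inter> space lebesgue \<in> sets (lebesgue :: ((real^'n) \<times> (real^'n)) measure)"
      by (rule measurable_sets[OF measurable_fst_lebesgue \<Omega>])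
    have "{p. fst p \<in> \<Omega> \<and> dist (\<psi>0 (fst p) z) (snd p) < e} =
        {p \<in> space lebesgue. dist (h (fst p)) (snd p) < e} \<inter> (fst -` \<Omega> \<inter> space lebesgue)"
      by (auto simp: h_def)
    then show ?thesis
      using 1 2 by simp
  qed
  have "T n m \<in> sets lebesgue" for n m
    unfolding T_def using D(1) near by (rule sets.countable_UN'')
  then have S: "S \<in> sets lebesgue"
    unfolding S_def by (intro sets.countable_nat_UN sets.countable_INT image_subsetI) simp_all
  have "AE x in lebesgue_on \<Omega>. C1_closure Ystar (\<psi>0 x)"
    "AE x in lebesgue_on \<Omega>. C1_diffeo_closure Ystar (\<psi>0 x) \<and> \<psi>0 x ` Ystar \<subseteq> Ycell"
    using trafo by (auto simp: limit_transformation_def linf_C1_def)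
  then have "AE x in lebesgue_on \<Omega>. continuous_on (closure Ystar) (\<psi>0 x) \<and> \<psi>0 x ` Ystar \<subseteq> Ycell"
    by eventually_elim (auto simp: C1_closure_def)
  moreover have \<Omega>': "\<Omega> \<inter> space lebesgue \<in> sets lebesgue"
    using \<Omega> by simp
  ultimately have "AE x in lebesgue. x \<in> \<Omega> \<longrightarrow>
      continuous_on (closure Ystar) (\<psi>0 x) \<and> \<psi>0 x ` Ystar \<subseteq> Ycell"
    by (simp only: AE_restrict_space_iff[OF \<Omega>'])
  from AE_lebesgue_fst[OF this, where 'b="real^'n"]
  have "AE p in lebesgue. p \<in> S \<longleftrightarrow> p \<in> Qset \<Omega> Ystar \<psi>0"
  proof eventually_elim
    case (elim p)
    show ?case
    proof (cases "fst p \<in> \<Omega>")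
      case True
      have cont: "continuous_on (C n) (\<psi>0 (fst p))" for n
      proof (rule continuous_on_subset)
        show "continuous_on (closure Ystar) (\<psi>0 (fst p))"
          using elim True by (rule mp[THEN conjunct1])
        show "C n \<subseteq> closure Ystar"
          using C(2) closure_subset by (rule order_trans)
      qed
      have "p \<in> (\<Inter>m. T n m) \<longleftrightarrow> snd p \<in> \<psi>0 (fst p) ` C n" for n
        unfolding compact_image_iff_countable[OF C(1) D(2) D(3) cont] T_def using True by simp
      then have "p \<in> S \<longleftrightarrow> snd p \<in> \<psi>0 (fst p) ` (\<Union>(range C))"
        by (simp only: S_def UN_iff image_UN)
      also have "\<dots> \<longleftrightarrow> snd p \<in> \<psi>0 (fst p) ` Ystar"
        by (simp only: C(3))
      also have "\<dots> \<longleftrightarrow> p \<in> Qset \<Omega> Ystar \<psi>0"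
        using True elim by (cases p) (auto simp: Qset_def Yx_def)
      finally show ?thesis .
    next
      case False
      then have "p \<notin> T n m" "p \<notin> Qset \<Omega> Ystar \<psi>0" for n m
        by (simp_all add: T_def Qset_def case_prod_beta)
      then show ?thesis
        by (simp add: S_def)
    qed
  qed
  then show ?thesis
    by (rule completion.in_sets_AE[OF _ S]) (simp only: space_completion space_lborel space_borel subset_UNIV)
qed

lemma cell_family_Qset:
  fixes \<Omega> Ystar :: "(real^'n) set"
  assumes "open \<Omega>" "open Ystar" and trafo: "limit_transformation \<Omega> Ystar \<psi>0"
  shows "cell_family \<Omega> (Yx Ystar \<psi>0) (Qset \<Omega> Ystar \<psi>0) Ycell"
proof
  show "\<Omega> \<in> sets lebesgue"
    using assms(1) by (auto intro!: sets_completionI_sets)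
  show "Qset \<Omega> Ystar \<psi>0 \<in> sets lebesgue"
    using assms by (rule sets_lebesgue_Qset)
  have "AE x in lebesgue_on \<Omega>. C1_diffeo_closure Ystar (\<psi>0 x) \<and> \<psi>0 x ` Ystar \<subseteq> Ycell"
    using trafo by (simp add: limit_transformation_def)
  moreover have "AE x in lebesgue_on \<Omega>. x \<in> \<Omega>"
    by (rule AE_I2) simp
  ultimately show "AE x in lebesgue_on \<Omega>. Yx Ystar \<psi>0 x = {y. (x, y) \<in> Qset \<Omega> Ystar \<psi>0}"
    by eventually_elim (auto simp: Qset_def Yx_def)
  show "Qset \<Omega> Ystar \<psi>0 \<subseteq> \<Omega> \<times> Ycell" "(Ycell :: (real^'n) set) \<in> fmeasurable lborel"
    using Ycell_fmeasurable by (auto simp: Qset_def)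
qed

section \<open>Multiplying test functions by functions of the slow variable\<close>

lemma has_weak_gradient_scale:
  assumes "has_weak_gradient u Du U"
  shows "has_weak_gradient (\<lambda>x. c * u x) (\<lambda>x. c *\<^sub>R Du x) U"
  unfolding has_weak_gradient_def
proof (intro conjI allI impI ballI)
  fix K assume "compact K \<and> K \<subseteq> U"
  then show "integrable (lebesgue_on K) (\<lambda>x. c * u x)" "integrable (lebesgue_on K) (\<lambda>x. c *\<^sub>R Du x)"
    using assms by (auto simp: has_weak_gradient_def)
next
  fix \<phi> i assume \<phi>: "\<phi> \<in> test_functions U"
  have "(LINT x|lebesgue_on U. c * u x * frechet_derivative \<phi> (at x) (axis i 1)) =
      c * (LINT x|lebesgue_on U. u x * frechet_derivative \<phi> (at x) (axis i 1))"
    by (simp add: mult.assoc)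
  also have "\<dots> = c * - (LINT x|lebesgue_on U. Du x $ i * \<phi> x)"
    using assms \<phi> by (simp add: has_weak_gradient_def)
  finally show "(LINT x|lebesgue_on U. c * u x * frechet_derivative \<phi> (at x) (axis i 1)) =
      - (LINT x|lebesgue_on U. (c *\<^sub>R Du x) $ i * \<phi> x)"
    by (simp add: mult.assoc)
qed

lemma H1_scale:
  assumes "H1 U u Du"
  shows "H1 U (\<lambda>x. c * u x) (\<lambda>x. c *\<^sub>R Du x)"
  using assms lp_space_2_scale_const[of U u c] lp_space_2_scale_const[of U Du c]
  by (simp add: H1_def has_weak_gradient_scale)

lemma H1_loc_scale:
  assumes "H1_loc U u Du"
  shows "H1_loc U (\<lambda>x. c * u x) (\<lambda>x. c *\<^sub>R Du x)"
  using assms lp_space_2_scale_const[of _ u c] lp_space_2_scale_const[of _ Du c]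
  by (simp add: H1_loc_def has_weak_gradient_scale)

lemma H1_per_scale:
  assumes "H1_per Ystar v Dv"
  shows "H1_per Ystar (\<lambda>x. c * v x) (\<lambda>x. c *\<^sub>R Dv x)"
proof -
  from assms obtain w Dw where w: "H1_loc (periodic_hull Ystar) w Dw"
      "\<forall>y. \<forall>k \<in> int_vecs. w (y + k) = w y" and eq: "AE y in lebesgue_on Ystar. w y = v y"
    by (auto simp: H1_per_def)
  have "AE y in lebesgue_on Ystar. c * w y = c * v y"
    using eq by eventually_elim simp
  then show ?thesis
    using assms H1_scale H1_loc_scale[OF w(1), of c] w(2) unfolding H1_per_def
    by (intro conjI exI[of _ "\<lambda>y. c * w y"] exI[of _ "\<lambda>y. c *\<^sub>R Dw y"]) auto
qed

text \<open>For fixed \<open>x\<close> the factor \<open>c(x)\<close> is a constant, so the periodic Sobolev space of each cell is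
  preserved. Taking \<open>c = 0\<close> shows that the zero function is a test function.\<close>

lemma L2_H1_per_Yx_scale:
  fixes \<Omega> Ystar :: "(real^'n) set"
  assumes dom: "open \<Omega>" "open Ystar" "Ystar \<subseteq> Ycell"
    and cells: "cell_family \<Omega> (Yx Ystar \<psi>0) (Qset \<Omega> Ystar \<psi>0) Ycell"
    and u: "L2_H1_per_Yx \<Omega> Ystar \<psi>0 u Du"
    and c: "c \<in> borel_measurable (lebesgue_on \<Omega>)" "\<And>x. \<bar>c x\<bar> \<le> K"
  shows "L2_H1_per_Yx \<Omega> Ystar \<psi>0 (\<lambda>z. c (fst z) * u z) (\<lambda>z. c (fst z) *\<^sub>R Du z)"
proof -
  have c_const: "(\<lambda>z. c (fst z)) \<in> borel_measurable (lebesgue_on (\<Omega> \<times> Ystar))"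
    by (rule cell_family.measurable_from_base[OF cell_family_const[OF dom] c(1)])
  have c_Q: "(\<lambda>z. c (fst z)) \<in> borel_measurable (lebesgue_on (Qset \<Omega> Ystar \<psi>0))"
    by (rule cell_family.measurable_from_base[OF cells c(1)])
  from u obtain f Df where f: "L2_H1_per \<Omega> Ystar f Df" "pulled_back \<Omega> Ystar \<psi>0 u f"
    by (auto simp: L2_H1_per_Yx_def)
  have "L2_H1_per \<Omega> Ystar (\<lambda>z. c (fst z) * f z) (\<lambda>z. c (fst z) *\<^sub>R Df z)"
    unfolding L2_H1_per_def
  proof (intro conjI)
    show "lp_space (\<Omega> \<times> Ystar) 2 (\<lambda>z. c (fst z) * f z)" "lp_space (\<Omega> \<times> Ystar) 2 (\<lambda>z. c (fst z) *\<^sub>R Df z)"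
      using f(1) lp_space_2_scaleR[of _ f, OF _ c_const c(2)] lp_space_2_scaleR[of _ Df, OF _ c_const c(2)]
      by (auto simp: L2_H1_per_def)
    have "AE x in lebesgue_on \<Omega>. H1_per Ystar (\<lambda>y. f (x, y)) (\<lambda>y. Df (x, y))"
      using f(1) by (simp add: L2_H1_per_def)
    then show "AE x in lebesgue_on \<Omega>.
        H1_per Ystar (\<lambda>y. c (fst (x, y)) * f (x, y)) (\<lambda>y. c (fst (x, y)) *\<^sub>R Df (x, y))"
      by eventually_elim (simp add: H1_per_scale)
  qed
  moreover have "pulled_back \<Omega> Ystar \<psi>0 (\<lambda>z. c (fst z) * u z) (\<lambda>z. c (fst z) * f z)"
    using f(2) unfolding pulled_back_def by eventually_elim (auto split: prod.splits)
  moreover have "lp_space (Qset \<Omega> Ystar \<psi>0) 2 (\<lambda>z. c (fst z) * u z)"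
    "lp_space (Qset \<Omega> Ystar \<psi>0) 2 (\<lambda>z. c (fst z) *\<^sub>R Du z)"
    using u lp_space_2_scaleR[of _ u, OF _ c_Q c(2)] lp_space_2_scaleR[of _ Du, OF _ c_Q c(2)]
    by (auto simp: L2_H1_per_Yx_def)
  moreover have "AE x in lebesgue_on \<Omega>. has_weak_gradient (\<lambda>y. c (fst (x, y)) * u (x, y))
      (\<lambda>y. c (fst (x, y)) *\<^sub>R Du (x, y)) (Yx Ystar \<psi>0 x)"
  proof -
    have "AE x in lebesgue_on \<Omega>. has_weak_gradient (\<lambda>y. u (x, y)) (\<lambda>y. Du (x, y)) (Yx Ystar \<psi>0 x)"
      using u by (simp add: L2_H1_per_Yx_def)
    then show ?thesis
      by eventually_elim (simp add: has_weak_gradient_scale)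
  qed
  ultimately show ?thesis
    unfolding L2_H1_per_Yx_def by blast
qed

section \<open>Fibrewise consequences\<close>

text \<open>The weight \<open>c = sgn G\<close> turns the vanishing integral into the \<open>L\<^sup>1\<close> norm of \<open>G\<close>.\<close>

lemma AE_zero_if_weighted_integrals_zero:
  fixes G :: "'a \<Rightarrow> real"
  assumes "integrable M G"
    and "\<And>c. c \<in> borel_measurable M \<Longrightarrow> (\<And>x. \<bar>c x\<bar> \<le> 1) \<Longrightarrow> (LINT x|M. c x * G x) = 0"
  shows "AE x in M. G x = 0"
proof -
  have "(LINT x|M. sgn (G x) * G x) = 0"
    using assms(1) by (intro assms(2)) (auto simp: sgn_real_def)
  then have "(LINT x|M. \<bar>G x\<bar>) = 0"
    by (simp add: abs_sgn mult.commute)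
  then show ?thesis
    using assms(1) integral_nonneg_eq_0_iff_AE[of M "\<lambda>x. \<bar>G x\<bar>"] by simp
qed

text \<open>A weak equation on \<open>Q\<close> without derivatives in \<open>x\<close> decouples into one equation for each cell: the
  weights of the previous lemma can be absorbed into the test function.\<close>

lemma fibrewise_orthogonality:
  fixes \<Omega> Ystar :: "(real^'n) set" and F :: "(real^'n) \<times> (real^'n) \<Rightarrow> real^'n"
  assumes dom: "open \<Omega>" "open Ystar" "Ystar \<subseteq> Ycell"
    and cells: "cell_family \<Omega> (Yx Ystar \<psi>0) (Qset \<Omega> Ystar \<psi>0) Ycell"
    and F: "lp_space (Qset \<Omega> Ystar \<psi>0) 2 F"
    and zero: "\<And>\<phi> D\<phi>. L2_H1_per_Yx \<Omega> Ystar \<psi>0 \<phi> D\<phi> \<Longrightarrow>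
        (LINT x|lebesgue_on \<Omega>. LINT y|lebesgue_on (Yx Ystar \<psi>0 x). F (x, y) \<bullet> D\<phi> (x, y)) = 0"
    and u: "L2_H1_per_Yx \<Omega> Ystar \<psi>0 u Du"
  shows "AE x in lebesgue_on \<Omega>. (LINT y|lebesgue_on (Yx Ystar \<psi>0 x). F (x, y) \<bullet> Du (x, y)) = 0"
proof (rule AE_zero_if_weighted_integrals_zero)
  have "lp_space (Qset \<Omega> Ystar \<psi>0) 2 Du"
    using u by (simp add: L2_H1_per_Yx_def)
  then show "integrable (lebesgue_on \<Omega>) (\<lambda>x. LINT y|lebesgue_on (Yx Ystar \<psi>0 x). F (x, y) \<bullet> Du (x, y))"
    by (intro cell_family.integrable_fibres(2)[OF cells] integrable_inner_lp_space_2 F)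
  fix c :: "real^'n \<Rightarrow> real"
  assume "c \<in> borel_measurable (lebesgue_on \<Omega>)" "\<And>x. \<bar>c x\<bar> \<le> 1"
  from zero[OF L2_H1_per_Yx_scale[OF dom cells u this]]
  show "(LINT x|lebesgue_on \<Omega>. c x * (LINT y|lebesgue_on (Yx Ystar \<psi>0 x). F (x, y) \<bullet> Du (x, y))) = 0"
    by simp
qed

text \<open>Uniqueness of the corrector on one cell. With \<open>p = \<nabla>u0(x)\<close>, \<open>q = \<nabla>\<^sub>y u1\<close> and \<open>d\<^sub>j = \<nabla>\<^sub>y w\<^sub>j\<close> the
  orthogonality relations add up to a vanishing energy of \<open>v = q - (\<Sum>j. p\<^sub>j d\<^sub>j)\<close>. The relations are
  assumed for \<open>q\<close> and each \<open>d\<^sub>i\<close> separately, as \<open>v\<close> itself need not come from a test function.\<close>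

lemma coercive_superposition:
  fixes a :: "'a \<Rightarrow> real^'n^'n" and d :: "'n \<Rightarrow> 'a \<Rightarrow> real^'n"
  assumes coercive: "\<alpha> > 0" "AE y in M. \<forall>\<xi>. \<xi> \<bullet> (a y *v \<xi>) \<ge> \<alpha> * (norm \<xi>)\<^sup>2"
    and int: "integrable M (\<lambda>y. (a y *v (p + q y)) \<bullet> q y)"
      "\<And>i. integrable M (\<lambda>y. (a y *v (p + q y)) \<bullet> d i y)"
      "\<And>j. integrable M (\<lambda>y. (a y *v (d j y + axis j 1)) \<bullet> q y)"
      "\<And>i j. integrable M (\<lambda>y. (a y *v (d j y + axis j 1)) \<bullet> d i y)"
    and zero: "(LINT y|M. (a y *v (p + q y)) \<bullet> q y) = 0"
      "\<And>i. (LINT y|M. (a y *v (p + q y)) \<bullet> d i y) = 0"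
      "\<And>j. (LINT y|M. (a y *v (d j y + axis j 1)) \<bullet> q y) = 0"
      "\<And>i j. (LINT y|M. (a y *v (d j y + axis j 1)) \<bullet> d i y) = 0"
  shows "AE y in M. p + q y = (\<Sum>j\<in>UNIV. p $ j *\<^sub>R (d j y + axis j 1))"
proof -
  define v where "v y = q y - (\<Sum>j\<in>UNIV. p $ j *\<^sub>R d j y)" for y
  have p: "p = (\<Sum>j\<in>UNIV. p $ j *\<^sub>R axis j 1)"
    using basis_expansion[of p] by (simp add: scalar_mult_eq_scaleR)
  have split: "p + q y - (\<Sum>j\<in>UNIV. p $ j *\<^sub>R (d j y + axis j 1)) = v y" for y
    unfolding v_def by (subst p) (simp add: scaleR_add_right sum.distrib)
  have av: "a y *v v y = a y *v (p + q y) - (\<Sum>j\<in>UNIV. p $ j *\<^sub>R (a y *v (d j y + axis j 1)))" for y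
    unfolding split[symmetric] matrix_vector_mult_diff_distrib linear_sum[OF matrix_vector_mul_linear]
    by (simp add: matrix_vector_mult_scaleR)
  have expand: "(a y *v v y) \<bullet> v y =
      (a y *v (p + q y)) \<bullet> q y - (\<Sum>i\<in>UNIV. p $ i * ((a y *v (p + q y)) \<bullet> d i y))
      - (\<Sum>j\<in>UNIV. p $ j * ((a y *v (d j y + axis j 1)) \<bullet> q y
          - (\<Sum>i\<in>UNIV. p $ i * ((a y *v (d j y + axis j 1)) \<bullet> d i y))))" for y
  proof -
    have pair: "F \<bullet> v y = F \<bullet> q y - (\<Sum>i\<in>UNIV. p $ i * (F \<bullet> d i y))" for F
      by (simp add: v_def inner_diff_right inner_sum_right)
    have "(a y *v v y) \<bullet> v y = (a y *v (p + q y)) \<bullet> v y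
        - (\<Sum>j\<in>UNIV. p $ j * ((a y *v (d j y + axis j 1)) \<bullet> v y))"
      by (simp add: av inner_diff_left inner_sum_left)
    then show ?thesis
      by (simp only: pair)
  qed
  have int_e: "integrable M (\<lambda>y. (a y *v v y) \<bullet> v y)"
    unfolding expand using int
    by (intro Bochner_Integration.integrable_diff Bochner_Integration.integrable_sum integrable_mult_right) auto
  have zero_e: "(LINT y|M. (a y *v v y) \<bullet> v y) = 0"
    unfolding expand using int by (simp add: zero)
  have lower: "AE y in M. \<alpha> * (norm (v y))\<^sup>2 \<le> (a y *v v y) \<bullet> v y"
    using coercive(2) by eventually_elim (simp add: inner_commute)
  have "AE y in M. (a y *v v y) \<bullet> v y = 0"
  proof -
    have "AE y in M. 0 \<le> (a y *v v y) \<bullet> v y"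
      using lower by eventually_elim (use coercive(1) in \<open>auto intro: order_trans[rotated]\<close>)
    then show ?thesis
      using integral_nonneg_eq_0_iff_AE[OF int_e] zero_e by simp
  qed
  with lower show ?thesis
  proof eventually_elim
    case (elim y)
    then have "v y = 0"
      using coercive(1) by (simp add: mult_le_0_iff)
    then show ?case
      using split[of y] by simp
  qed
qed

text \<open>The corrector equation tested with the corrector itself:
  \<open>\<alpha> \<integral>|d|\<^sup>2 \<le> \<integral>a d \<cdot> d = - \<integral>a e \<cdot> d\<close>, and Young's inequality
  \<open>C |d| \<le> \<alpha>/2 |d|\<^sup>2 + C\<^sup>2/(2\<alpha>)\<close> absorbs the right-hand side. The constant does not depend on the
  cell, only on the bounds of the coefficient.\<close>

lemma corrector_energy_bound:
  fixes a :: "'a \<Rightarrow> real^'n^'n" and d :: "'a \<Rightarrow> real^'n"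
  assumes "finite_measure M" and mass: "measure M (space M) \<le> 1"
    and coercive: "\<alpha> > 0" "AE y in M. \<forall>\<xi>. \<xi> \<bullet> (a y *v \<xi>) \<ge> \<alpha> * (norm \<xi>)\<^sup>2"
    and bound: "AE y in M. norm (a y) \<le> C" "C \<ge> 0"
    and e: "norm e = 1"
    and int: "integrable M (\<lambda>y. (norm (d y))\<^sup>2)" "integrable M (\<lambda>y. (a y *v (d y + e)) \<bullet> d y)"
    and zero: "(LINT y|M. (a y *v (d y + e)) \<bullet> d y) = 0"
  shows "(LINT y|M. (norm (d y))\<^sup>2) \<le> (C / \<alpha>)\<^sup>2"
proof -
  interpret finite_measure M by fact
  have "AE y in M. \<alpha> / 2 * (norm (d y))\<^sup>2 - C\<^sup>2 / (2 * \<alpha>) \<le> (a y *v (d y + e)) \<bullet> d y"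
    using coercive(2) bound(1)
  proof eventually_elim
    case (elim y)
    let ?n = "norm (d y)"
    have "\<bar>(a y *v e) \<bullet> d y\<bar> \<le> norm (a y *v e) * ?n"
      by (rule Cauchy_Schwarz_ineq2)
    also have "\<dots> \<le> C * ?n"
      using norm_matrix_vector_mult_le[of "a y" e] e elim(2) by (intro mult_right_mono) auto
    also have "\<dots> \<le> \<alpha> / 2 * ?n\<^sup>2 + C\<^sup>2 / (2 * \<alpha>)"
    proof -
      have "0 \<le> (\<alpha> * ?n - C)\<^sup>2 / (2 * \<alpha>)"
        using coercive(1) by simp
      also have "\<dots> = \<alpha> / 2 * ?n\<^sup>2 + C\<^sup>2 / (2 * \<alpha>) - C * ?n"
        using coercive(1) by (simp add: power2_eq_square field_simps)
      finally show ?thesis by simp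
    qed
    finally have "\<bar>(a y *v e) \<bullet> d y\<bar> \<le> \<alpha> / 2 * ?n\<^sup>2 + C\<^sup>2 / (2 * \<alpha>)" .
    moreover have "(a y *v d y) \<bullet> d y \<ge> \<alpha> * ?n\<^sup>2"
      using elim(1) by (simp add: inner_commute)
    ultimately show ?case
      by (simp add: matrix_vector_right_distrib inner_add_left)
  qed
  then have "(LINT y|M. \<alpha> / 2 * (norm (d y))\<^sup>2 - C\<^sup>2 / (2 * \<alpha>)) \<le> (LINT y|M. (a y *v (d y + e)) \<bullet> d y)"
    using int by (intro integral_mono_AE) auto
  then have "\<alpha> / 2 * (LINT y|M. (norm (d y))\<^sup>2) \<le> C\<^sup>2 / (2 * \<alpha>) * measure M (space M)"
    using int by (simp add: zero mult.commute)
  also have "\<dots> \<le> C\<^sup>2 / (2 * \<alpha>) * 1"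
    using mass coercive(1) by (intro mult_left_mono) auto
  finally show ?thesis
    using coercive(1) by (simp add: field_simps power2_eq_square)
qed

text \<open>The inequality \<open>|d| \<le> 1 + |d|\<^sup>2\<close> bounds the mean flux by the energy.\<close>

lemma corrector_flux_bound:
  fixes a :: "'a \<Rightarrow> real^'n^'n" and d :: "'a \<Rightarrow> real^'n"
  assumes "finite_measure M" and mass: "measure M (space M) \<le> 1"
    and bound: "AE y in M. norm (a y) \<le> C" "C \<ge> 0"
    and e: "norm e = 1"
    and int: "integrable M (\<lambda>y. (norm (d y))\<^sup>2)" "integrable M (\<lambda>y. (a y *v (e + d y)) $ i)"
    and energy: "(LINT y|M. (norm (d y))\<^sup>2) \<le> K"
  shows "\<bar>LINT y|M. (a y *v (e + d y)) $ i\<bar> \<le> C * (2 + K)"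
proof -
  interpret finite_measure M by fact
  have "\<bar>LINT y|M. (a y *v (e + d y)) $ i\<bar> \<le> (LINT y|M. \<bar>(a y *v (e + d y)) $ i\<bar>)"
    by (rule integral_abs_bound)
  also have "\<dots> \<le> (LINT y|M. C * (2 + (norm (d y))\<^sup>2))"
  proof (rule integral_mono_AE)
    show "AE y in M. \<bar>(a y *v (e + d y)) $ i\<bar> \<le> C * (2 + (norm (d y))\<^sup>2)"
      using bound(1)
    proof eventually_elim
      case (elim y)
      have "\<bar>(a y *v (e + d y)) $ i\<bar> \<le> norm (a y) * norm (e + d y)"
        using component_le_norm_cart norm_matrix_vector_mult_le by (rule order_trans)
      also have "\<dots> \<le> C * (2 + (norm (d y))\<^sup>2)"
      proof (intro mult_mono)
        have "norm (d y) \<le> 1 + (norm (d y))\<^sup>2"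
          using zero_le_power2[of "norm (d y) - 1 / 2"] by (simp add: power2_eq_square algebra_simps)
        then show "norm (e + d y) \<le> 2 + (norm (d y))\<^sup>2"
          using norm_triangle_ineq[of e "d y"] e by simp
      qed (use elim bound(2) in auto)
      finally show ?case .
    qed
  qed (use int in auto)
  also have "\<dots> = C * (2 * measure M (space M) + (LINT y|M. (norm (d y))\<^sup>2))"
    using int by (simp add: mult.commute)
  also have "\<dots> \<le> C * (2 + K)"
    using mass energy bound(2) by (intro mult_left_mono) auto
  finally show ?thesis .
qed

section \<open>The homogenised problem\<close>

context
  fixes \<Omega> Ystar :: "(real^'n) set" and \<psi>0 :: "real^'n \<Rightarrow> real^'n \<Rightarrow> real^'n"
    and A0 :: "(real^'n) \<times> (real^'n) \<Rightarrow> real^'n^'n"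
    and w :: "'n \<Rightarrow> (real^'n) \<times> (real^'n) \<Rightarrow> real"
    and Dw :: "'n \<Rightarrow> (real^'n) \<times> (real^'n) \<Rightarrow> real^'n"
  assumes dom: "open \<Omega>" "bounded \<Omega>" "open Ystar" "Ystar \<subseteq> Ycell"
    and trafo: "limit_transformation \<Omega> Ystar \<psi>0"
    and A0: "linf_space (Qset \<Omega> Ystar \<psi>0) A0" "coercive_on (Qset \<Omega> Ystar \<psi>0) A0"
    and cell: "\<And>j. cell_solution \<Omega> Ystar \<psi>0 A0 j (w j) (Dw j)"
begin

abbreviation (input) "Q \<equiv> Qset \<Omega> Ystar \<psi>0"
abbreviation (input) "fibre x \<equiv> lebesgue_on (Yx Ystar \<psi>0 x)"

interpretation cells: cell_family \<Omega> "Yx Ystar \<psi>0" "Qset \<Omega> Ystar \<psi>0" Ycell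
  using dom trafo by (intro cell_family_Qset)

lemma total_lmeasurable: "Q \<in> lmeasurable"
proof (rule bounded_set_imp_lmeasurable)
  have "bounded (\<Omega> \<times> (Ycell :: (real^'n) set))"
    using dom(2) by (intro bounded_Times) (auto simp: Ycell_def)
  then show "bounded Q"
    using cells.bounded_box(1) bounded_subset by blast
qed (rule cells.total)

lemma cell_gradient:
  shows "L2_H1_per_Yx \<Omega> Ystar \<psi>0 (w j) (Dw j)" "lp_space Q 2 (Dw j)"
  using cell[of j] by (auto simp: cell_solution_def L2_H1_per_Yx_def)

lemma cell_flux: "lp_space Q 2 (\<lambda>z. A0 z *v (Dw j z + axis j 1))"
  by (intro lp_space_2_matrix_vector_mult A0 lp_space_2_add cell_gradient lp_space_2_const total_lmeasurable)

lemma cell_flux_orthogonal: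
  assumes "L2_H1_per_Yx \<Omega> Ystar \<psi>0 u Du"
  shows "AE x in lebesgue_on \<Omega>. (LINT y|fibre x. (A0 (x, y) *v (Dw j (x, y) + axis j 1)) \<bullet> Du (x, y)) = 0"
  using fibrewise_orthogonality[OF dom(1,3,4) cells.cell_family_axioms cell_flux _ assms] cell[of j]
  by (simp add: cell_solution_def)

lemma integrable_flux_component:
  fixes F :: "(real^'n) \<times> (real^'n) \<Rightarrow> real^'n"
  assumes "lp_space Q 2 F"
  shows "integrable (lebesgue_on Q) (\<lambda>z. F z $ i)"
  using integrable_inner_lp_space_2[OF assms lp_space_2_const[OF total_lmeasurable, of "axis i 1"]]
  by (simp add: inner_axis)

text \<open>Measurability is Fubini's theorem; the bound is uniform in \<open>x\<close> because every cell lies in the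
  unit cell, whose measure is one.\<close>

lemma linf_homogenised_matrix: "linf_space \<Omega> (homogenised_matrix Ystar \<psi>0 A0 Dw)"
proof -
  have flux_int: "integrable (lebesgue_on Q) (\<lambda>z. (A0 z *v (axis j 1 + Dw j z)) $ i)" for i j
    using integrable_flux_component[OF cell_flux] by (simp add: add.commute)
  have meas: "homogenised_matrix Ystar \<psi>0 A0 Dw \<in> borel_measurable (lebesgue_on \<Omega>)"
  proof (rule borel_measurable_matrix)
    fix i j
    show "(\<lambda>x. homogenised_matrix Ystar \<psi>0 A0 Dw x $ i $ j) \<in> borel_measurable (lebesgue_on \<Omega>)"
      using borel_measurable_integrable[OF cells.integrable_fibres(2)[OF flux_int[of j i]]]
      by (simp add: homogenised_matrix_def)
  qed
  obtain C0 where C0: "AE z in lebesgue_on Q. norm (A0 z) \<le> C0"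
    using A0(1) by (auto simp: linf_space_def)
  \<comment> \<open>The bound \<open>C0\<close> may be negative if \<open>Q\<close> is a null set.\<close>
  define C where "C = max C0 0"
  have "AE z in lebesgue_on Q. norm (A0 z) \<le> C"
    using C0 unfolding C_def by eventually_elim simp
  then have C: "AE x in lebesgue_on \<Omega>. AE y in fibre x. norm (A0 (x, y)) \<le> C"
    by (rule cells.AE_fibres)
  have "C \<ge> 0"
    by (simp add: C_def)
  obtain \<alpha> where \<alpha>: "\<alpha> > 0" "AE z in lebesgue_on Q. \<forall>\<xi>. \<xi> \<bullet> (A0 z *v \<xi>) \<ge> \<alpha> * (norm \<xi>)\<^sup>2"
    using A0(2) by (auto simp: coercive_on_def)
  have entry: "AE x in lebesgue_on \<Omega>. \<bar>homogenised_matrix Ystar \<psi>0 A0 Dw x $ i $ j\<bar> \<le> C * (2 + (C / \<alpha>)\<^sup>2)" for i j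
  proof -
    have Dw_int: "integrable (lebesgue_on Q) (\<lambda>z. (norm (Dw j z))\<^sup>2)"
      using cell_gradient(2) by (simp add: lp_space_2_iff)
    have flux_Dw_int: "integrable (lebesgue_on Q) (\<lambda>z. (A0 z *v (Dw j z + axis j 1)) \<bullet> Dw j z)"
      by (intro integrable_inner_lp_space_2 cell_flux cell_gradient)
    show ?thesis
      using cells.AE_finite_fibre C cells.AE_fibres[OF \<alpha>(2)] cell_flux_orthogonal[OF cell_gradient(1), of j j]
        cells.integrable_fibres(1)[OF Dw_int] cells.integrable_fibres(1)[OF flux_Dw_int]
        cells.integrable_fibres(1)[OF flux_int[of j i]]
    proof eventually_elim
      case (elim x)
      have mass: "measure (fibre x) (space (fibre x)) \<le> 1"
        using elim(1) by (simp add: measure_Ycell)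
      have e: "norm (axis j 1 :: real^'n) = 1"
        by simp
      have "(LINT y|fibre x. (norm (Dw j (x, y)))\<^sup>2) \<le> (C / \<alpha>)\<^sup>2"
        using elim mass e by (intro corrector_energy_bound[OF _ _ \<alpha>(1) _ _ \<open>C \<ge> 0\<close>]) auto
      then show ?case
        unfolding homogenised_matrix_def using elim mass e
        by (auto intro!: corrector_flux_bound[OF _ _ _ \<open>C \<ge> 0\<close>])
    qed
  qed
  have "AE x in lebesgue_on \<Omega>. \<forall>i j. \<bar>homogenised_matrix Ystar \<psi>0 A0 Dw x $ i $ j\<bar> \<le> C * (2 + (C / \<alpha>)\<^sup>2)"
    using entry by (simp add: AE_all_countable)
  then have "AE x in lebesgue_on \<Omega>. norm (homogenised_matrix Ystar \<psi>0 A0 Dw x) \<le>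
      real CARD('n) * (real CARD('n) * (C * (2 + (C / \<alpha>)\<^sup>2)))"
    by eventually_elim (simp add: norm_matrix_le)
  then have "\<exists>K. AE x in lebesgue_on \<Omega>. norm (homogenised_matrix Ystar \<psi>0 A0 Dw x) \<le> K"
    by (rule exI)
  with meas show ?thesis
    unfolding linf_space_def by (rule conjI)
qed

lemma lp_space_2_from_base:
  fixes g :: "real^'n \<Rightarrow> 'b::euclidean_space"
  assumes "lp_space \<Omega> 2 g"
  shows "lp_space Q 2 (\<lambda>z. g (fst z))"
  using assms cells.measurable_from_base[of g] cells.integrable_from_base[of "\<lambda>x. (norm (g x))\<^sup>2"]
  by (simp add: lp_space_2_iff)

lemma two_scale_flux:
  assumes sol: "two_scale_solution \<Omega> Ystar \<psi>0 A0 f0 u0 Du0 u1 Du1"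
  shows "lp_space Q 2 (\<lambda>z. A0 z *v (Du0 (fst z) + Du1 z))"
  using sol
  by (intro lp_space_2_matrix_vector_mult A0 lp_space_2_add lp_space_2_from_base)
     (auto simp: two_scale_solution_def H1_def L2_H1_per_Yx_def)

text \<open>The choice \<open>\<phi>0 = 0\<close> removes the lower order term and the right-hand side from the two-scale
  equation.\<close>

lemma two_scale_flux_orthogonal:
  assumes sol: "two_scale_solution \<Omega> Ystar \<psi>0 A0 f0 u0 Du0 u1 Du1"
    and u: "L2_H1_per_Yx \<Omega> Ystar \<psi>0 u Du"
  shows "AE x in lebesgue_on \<Omega>. (LINT y|fibre x. (A0 (x, y) *v (Du0 x + Du1 (x, y))) \<bullet> Du (x, y)) = 0"
proof -
  have "H1 \<Omega> u0 Du0"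
    using sol by (simp add: two_scale_solution_def)
  from H1_scale[OF this, of 0] have H1_zero: "H1 \<Omega> (\<lambda>_. 0) (\<lambda>_. 0)"
    by simp
  have "(LINT x|lebesgue_on \<Omega>. LINT y|fibre x. (A0 (x, y) *v (Du0 x + Du1 (x, y))) \<bullet> D\<phi> (x, y)) = 0"
    if "L2_H1_per_Yx \<Omega> Ystar \<psi>0 \<phi> D\<phi>" for \<phi> D\<phi>
  proof -
    have "(LINT x|lebesgue_on \<Omega>. LINT y|fibre x.
          (A0 (x, y) *v (Du0 x + Du1 (x, y))) \<bullet> (0 + D\<phi> (x, y)) + u0 x * 0) =
        (LINT x|lebesgue_on \<Omega>. (LINT y|fibre x. f0 (x, y)) * 0)"
      using sol H1_zero that unfolding two_scale_solution_def by blast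
    then show ?thesis
      by simp
  qed
  then show ?thesis
    using fibrewise_orthogonality[OF dom(1,3,4) cells.cell_family_axioms two_scale_flux[OF sol] _ u]
    by simp
qed

text \<open>Elimination of \<open>u1\<close>: on almost every cell \<open>\<nabla>u0 + \<nabla>\<^sub>y u1\<close> is the combination of the vectors
  \<open>e\<^sub>j + \<nabla>\<^sub>y w\<^sub>j\<close> with coefficients \<open>\<partial>\<^sub>j u0(x)\<close>, and \<open>B0\<close> collects the integrated fluxes of these.\<close>

lemma homogenised_flux:
  assumes sol: "two_scale_solution \<Omega> Ystar \<psi>0 A0 f0 u0 Du0 u1 Du1"
  shows "AE x in lebesgue_on \<Omega>. \<forall>i. integrable (fibre x) (\<lambda>y. (A0 (x, y) *v (Du0 x + Du1 (x, y))) $ i) \<and>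
    (LINT y|fibre x. (A0 (x, y) *v (Du0 x + Du1 (x, y))) $ i) = (homogenised_matrix Ystar \<psi>0 A0 Dw x *v Du0 x) $ i"
proof -
  have u1: "L2_H1_per_Yx \<Omega> Ystar \<psi>0 u1 Du1" "lp_space Q 2 Du1"
    using sol by (auto simp: two_scale_solution_def L2_H1_per_Yx_def)
  note flux = two_scale_flux[OF sol]
  obtain \<alpha> where \<alpha>: "\<alpha> > 0" "AE z in lebesgue_on Q. \<forall>\<xi>. \<xi> \<bullet> (A0 z *v \<xi>) \<ge> \<alpha> * (norm \<xi>)\<^sup>2"
    using A0(2) by (auto simp: coercive_on_def)
  have int: "AE x in lebesgue_on \<Omega>. integrable (fibre x) (\<lambda>y. (A0 (x, y) *v (Du0 x + Du1 (x, y))) \<bullet> Du1 (x, y))"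
    "AE x in lebesgue_on \<Omega>. \<forall>i. integrable (fibre x) (\<lambda>y. (A0 (x, y) *v (Du0 x + Du1 (x, y))) \<bullet> Dw i (x, y))"
    "AE x in lebesgue_on \<Omega>. \<forall>j. integrable (fibre x) (\<lambda>y. (A0 (x, y) *v (Dw j (x, y) + axis j 1)) \<bullet> Du1 (x, y))"
    "AE x in lebesgue_on \<Omega>. \<forall>i j. integrable (fibre x) (\<lambda>y. (A0 (x, y) *v (Dw j (x, y) + axis j 1)) \<bullet> Dw i (x, y))"
    "AE x in lebesgue_on \<Omega>. \<forall>i. integrable (fibre x) (\<lambda>y. (A0 (x, y) *v (Du0 x + Du1 (x, y))) $ i)"
    "AE x in lebesgue_on \<Omega>. \<forall>i j. integrable (fibre x) (\<lambda>y. (A0 (x, y) *v (Dw j (x, y) + axis j 1)) $ i)"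
    unfolding AE_all_countable
    using cells.integrable_fibres(1)[OF integrable_inner_lp_space_2[OF flux u1(2)]]
      cells.integrable_fibres(1)[OF integrable_inner_lp_space_2[OF flux cell_gradient(2)]]
      cells.integrable_fibres(1)[OF integrable_inner_lp_space_2[OF cell_flux u1(2)]]
      cells.integrable_fibres(1)[OF integrable_inner_lp_space_2[OF cell_flux cell_gradient(2)]]
      cells.integrable_fibres(1)[OF integrable_flux_component[OF flux]]
      cells.integrable_fibres(1)[OF integrable_flux_component[OF cell_flux]]
    by simp_all
  have zero: "AE x in lebesgue_on \<Omega>. (LINT y|fibre x. (A0 (x, y) *v (Du0 x + Du1 (x, y))) \<bullet> Du1 (x, y)) = 0"
    "AE x in lebesgue_on \<Omega>. \<forall>i. (LINT y|fibre x. (A0 (x, y) *v (Du0 x + Du1 (x, y))) \<bullet> Dw i (x, y)) = 0"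
    "AE x in lebesgue_on \<Omega>. \<forall>j. (LINT y|fibre x. (A0 (x, y) *v (Dw j (x, y) + axis j 1)) \<bullet> Du1 (x, y)) = 0"
    "AE x in lebesgue_on \<Omega>. \<forall>i j. (LINT y|fibre x. (A0 (x, y) *v (Dw j (x, y) + axis j 1)) \<bullet> Dw i (x, y)) = 0"
    unfolding AE_all_countable
    using two_scale_flux_orthogonal[OF sol] cell_flux_orthogonal u1(1) cell_gradient(1) by blast+
  show ?thesis
    using int zero cells.AE_fibres[OF \<alpha>(2)]
  proof eventually_elim
    case (elim x)
    let ?e = "\<lambda>j y. A0 (x, y) *v (Dw j (x, y) + axis j 1)"
    have "AE y in fibre x. Du0 x + Du1 (x, y) = (\<Sum>j\<in>UNIV. Du0 x $ j *\<^sub>R (Dw j (x, y) + axis j 1))"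
      using elim by (intro coercive_superposition[OF \<alpha>(1)]) auto
    then have "AE y in fibre x. A0 (x, y) *v (Du0 x + Du1 (x, y)) = (\<Sum>j\<in>UNIV. Du0 x $ j *\<^sub>R ?e j y)"
      by eventually_elim (simp add: linear_sum[OF matrix_vector_mul_linear] matrix_vector_mult_scaleR)
    then have flux_eq: "AE y in fibre x. (A0 (x, y) *v (Du0 x + Du1 (x, y))) $ i = (\<Sum>j\<in>UNIV. Du0 x $ j * ?e j y $ i)" for i
      by eventually_elim simp
    have "(LINT y|fibre x. (A0 (x, y) *v (Du0 x + Du1 (x, y))) $ i) = (homogenised_matrix Ystar \<psi>0 A0 Dw x *v Du0 x) $ i" for i
    proof -
      have "integrable (fibre x) (\<lambda>y. (A0 (x, y) *v (Du0 x + Du1 (x, y))) $ i)" "\<And>j. integrable (fibre x) (\<lambda>y. ?e j y $ i)"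
        using elim by auto
      then have "(LINT y|fibre x. (A0 (x, y) *v (Du0 x + Du1 (x, y))) $ i) = (LINT y|fibre x. (\<Sum>j\<in>UNIV. Du0 x $ j * ?e j y $ i))"
        using flux_eq[of i]
        by (intro integral_cong_AE borel_measurable_integrable Bochner_Integration.integrable_sum integrable_mult_right)
      also have "\<dots> = (\<Sum>j\<in>UNIV. Du0 x $ j * (LINT y|fibre x. ?e j y $ i))"
        using \<open>\<And>j. integrable (fibre x) (\<lambda>y. ?e j y $ i)\<close> by simp
      also have "\<dots> = (homogenised_matrix Ystar \<psi>0 A0 Dw x *v Du0 x) $ i"
        by (simp add: matrix_vector_mult_def homogenised_matrix_def add.commute mult.commute)
      finally show ?thesis .
    qed
    then show ?case
      using elim by blast
  qed
qed

text \<open>With \<open>\<phi>1 = 0\<close> only the flux depends on \<open>y\<close>: \<open>\<phi>\<close>, \<open>\<nabla>\<phi>\<close> and \<open>u0\<close> leave the inner integral, and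
  the lower order term acquires the measure of the cell.\<close>

lemma homogenised_equation:
  assumes sol: "two_scale_solution \<Omega> Ystar \<psi>0 A0 f0 u0 Du0 u1 Du1" and \<phi>: "H1 \<Omega> \<phi> D\<phi>"
  shows "(LINT x|lebesgue_on \<Omega>.
         (homogenised_matrix Ystar \<psi>0 A0 Dw x *v Du0 x) \<bullet> D\<phi> x
           + porosity Ystar \<psi>0 x * u0 x * \<phi> x) =
      (LINT x|lebesgue_on \<Omega>. (LINT y|lebesgue_on (Yx Ystar \<psi>0 x). f0 (x, y)) * \<phi> x)"
    (is "(LINT x|_. ?macro x) = _")
proof -
  let ?flux = "\<lambda>x y. A0 (x, y) *v (Du0 x + Du1 (x, y))"
  have u0: "lp_space \<Omega> 2 u0" "lp_space \<Omega> 2 Du0" and \<phi>_L2: "lp_space \<Omega> 2 \<phi>" "lp_space \<Omega> 2 D\<phi>"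
    using sol \<phi> by (auto simp: two_scale_solution_def H1_def)
  have u1: "L2_H1_per_Yx \<Omega> Ystar \<psi>0 u1 Du1"
    using sol by (simp add: two_scale_solution_def)
  have "L2_H1_per_Yx \<Omega> Ystar \<psi>0 (\<lambda>_. 0) (\<lambda>_. 0)"
    using L2_H1_per_Yx_scale[OF dom(1,3,4) cells.cell_family_axioms u1, of "\<lambda>_. 0" 0] by simp
  then have "(LINT x|lebesgue_on \<Omega>. LINT y|fibre x. ?flux x y \<bullet> (D\<phi> x + 0) + u0 x * \<phi> x) =
      (LINT x|lebesgue_on \<Omega>. (LINT y|fibre x. f0 (x, y)) * \<phi> x)"
    using sol \<phi> unfolding two_scale_solution_def by blast
  moreover have "(LINT x|lebesgue_on \<Omega>. LINT y|fibre x. ?flux x y \<bullet> (D\<phi> x + 0) + u0 x * \<phi> x) = (LINT x|lebesgue_on \<Omega>. ?macro x)"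
  proof (rule integral_cong_AE)
    have "integrable (lebesgue_on Q) (\<lambda>z. (A0 z *v (Du0 (fst z) + Du1 z)) \<bullet> D\<phi> (fst z) + u0 (fst z) \<bullet> \<phi> (fst z))"
      by (intro Bochner_Integration.integrable_add integrable_inner_lp_space_2 two_scale_flux[OF sol]
          lp_space_2_from_base u0 \<phi>_L2)
    from borel_measurable_integrable[OF cells.integrable_fibres(2)[OF this]]
    show "(\<lambda>x. LINT y|fibre x. ?flux x y \<bullet> (D\<phi> x + 0) + u0 x * \<phi> x) \<in> borel_measurable (lebesgue_on \<Omega>)"
      by simp
    have "integrable (lebesgue_on Q) (\<lambda>_. 1 :: real)"
      using finite_measure.integrable_const[OF finite_measure_lebesgue_on[OF total_lmeasurable]] .
    from borel_measurable_integrable[OF cells.integrable_fibres(2)[OF this]]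
    have "porosity Ystar \<psi>0 \<in> borel_measurable (lebesgue_on \<Omega>)"
      by (simp add: porosity_def[abs_def])
    then show "?macro \<in> borel_measurable (lebesgue_on \<Omega>)"
      using linf_homogenised_matrix u0 \<phi>_L2
      by (intro borel_measurable_add borel_measurable_inner borel_measurable_times borel_measurable_matrix_vector_mult)
         (auto simp: linf_space_def lp_space_2_iff)
    show "AE x in lebesgue_on \<Omega>. (LINT y|fibre x. ?flux x y \<bullet> (D\<phi> x + 0) + u0 x * \<phi> x) = ?macro x"
      using homogenised_flux[OF sol] cells.AE_finite_fibre
    proof eventually_elim
      case (elim x)
      interpret finite_measure "fibre x"
        using elim(2) by blast
      have "(LINT y|fibre x. ?flux x y \<bullet> (D\<phi> x + 0) + u0 x * \<phi> x) =
          (LINT y|fibre x. (\<Sum>i\<in>UNIV. ?flux x y $ i * D\<phi> x $ i) + u0 x * \<phi> x * 1)"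
        by (simp add: inner_vec_def)
      also have "\<dots> = (\<Sum>i\<in>UNIV. (LINT y|fibre x. ?flux x y $ i) * D\<phi> x $ i) + u0 x * \<phi> x * porosity Ystar \<psi>0 x"
        using elim(1) by (simp add: porosity_def mult.commute)
      also have "\<dots> = ?macro x"
        using elim(1) by (simp add: inner_vec_def mult_ac)
      finally show ?case .
    qed
  qed
  ultimately show ?thesis
    by simp
qed

end

theorem theorem4p7:
  fixes \<epsilon> :: "nat \<Rightarrow> real"
    and \<Omega> Ystar :: "(real^'n) set"
    and \<psi> :: "nat \<Rightarrow> real^'n \<Rightarrow> real^'n"
    and \<psi>0 :: "real^'n \<Rightarrow> real^'n \<Rightarrow> real^'n"
    and \<delta> :: real
    and A :: "nat \<Rightarrow> real^'n \<Rightarrow> real^'n^'n"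
    and A0 :: "(real^'n) \<times> (real^'n) \<Rightarrow> real^'n^'n"
    and f :: "nat \<Rightarrow> real^'n \<Rightarrow> real"
    and f0 :: "(real^'n) \<times> (real^'n) \<Rightarrow> real"
    and u0 :: "real^'n \<Rightarrow> real" and Du0 :: "real^'n \<Rightarrow> real^'n"
    and u1 :: "(real^'n) \<times> (real^'n) \<Rightarrow> real" and Du1 :: "(real^'n) \<times> (real^'n) \<Rightarrow> real^'n"
    and w :: "'n \<Rightarrow> (real^'n) \<times> (real^'n) \<Rightarrow> real"
    and Dw :: "'n \<Rightarrow> (real^'n) \<times> (real^'n) \<Rightarrow> real^'n"
  assumes eps: "\<And>n. \<epsilon> n > 0" "\<epsilon> \<longlonglongrightarrow> 0"
    and Omega: "open \<Omega>" "bounded \<Omega>" "lipschitz_boundary \<Omega>"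
    and Ystar: "open Ystar" "Ystar \<subseteq> Ycell" "lipschitz_boundary (periodic_hull Ystar)"
    and conn: "connected (periodic_hull Ystar)"
    and trafo: "locally_periodic_transformations \<epsilon> \<Omega> Ystar \<psi> \<psi>0"
    and delta: "\<delta> > 0"
    and A: "admissible_coefficients (transformed_domain \<epsilon> \<Omega> Ystar \<psi>) A"
    and A0: "linf_space (Qset \<Omega> Ystar \<psi>0) A0" "coercive_on (Qset \<Omega> Ystar \<psi>0) A0"
    and A_conv: "\<And>q. q > 1 \<Longrightarrow>
      two_scale_strongly (neighbourhood \<Omega> \<delta>) \<epsilon> q
        (\<lambda>n. ext0 (transformed_domain \<epsilon> \<Omega> Ystar \<psi> n) (A n)) (ext0 (Qset \<Omega> Ystar \<psi>0) A0)"
    and f: "\<And>n. lp_space (transformed_domain \<epsilon> \<Omega> Ystar \<psi> n) 2 (f n)"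
    and f0: "L2_L2_Yx \<Omega> Ystar \<psi>0 f0"
    and f_conv: "two_scale_weakly (neighbourhood \<Omega> \<delta>) \<epsilon> 2
        (\<lambda>n. ext0 (transformed_domain \<epsilon> \<Omega> Ystar \<psi> n) (f n)) (ext0 (Qset \<Omega> Ystar \<psi>0) f0)"
    and sol: "two_scale_solution \<Omega> Ystar \<psi>0 A0 f0 u0 Du0 u1 Du1"
    and cell: "\<And>j. cell_solution \<Omega> Ystar \<psi>0 A0 j (w j) (Dw j)"
  shows "linf_space \<Omega> (homogenised_matrix Ystar \<psi>0 A0 Dw) \<and>
    (\<forall>\<phi> D\<phi>. H1 \<Omega> \<phi> D\<phi> \<longrightarrow>
      (LINT x|lebesgue_on \<Omega>.
         (homogenised_matrix Ystar \<psi>0 A0 Dw x *v Du0 x) \<bullet> D\<phi> x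
           + porosity Ystar \<psi>0 x * u0 x * \<phi> x) =
      (LINT x|lebesgue_on \<Omega>. (LINT y|lebesgue_on (Yx Ystar \<psi>0 x). f0 (x, y)) * \<phi> x))"
proof -
  have limit: "limit_transformation \<Omega> Ystar \<psi>0"
    using trafo by (simp add: locally_periodic_transformations_def)
  note setting = Omega(1,2) Ystar(1,2) limit A0 cell
  show ?thesis
    by (intro conjI allI impI linf_homogenised_matrix[OF setting] homogenised_equation[OF setting sol])
qed

end
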